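(* Let $\alpha>\tfrac12$ and define $(\alpha_1,\gamma_1)=\left(\tfrac12\alpha+\tfrac14,\ \tfrac32\alpha-\tfrac14\right)$ and $T_{\rm p}=\tfrac{2\alpha-1}{4}\log m$ if $\tfrac12<\alpha\le\tfrac32$, and $(\alpha_1,\gamma_1)=(1,2)$ and $T_{\rm p}=(\alpha-1)\log m$ if $\alpha>\tfrac32$. Let $$T_1=\inf\Big\{t\ge 0:\ q_{\max}(t)\ge m^{-\alpha_1}\log m\ \text{ or }\ r_{\max}(t)\ge m^{-\gamma_1}(\log m)^3\Big\}.$$ Then for every $\delta\in(0,1)$ there exist $M$ and $C>0$ (independent of $m$) such that for all $m\ge M$, with probability at least $1-\delta$ over the random initialization $\theta(0)$: (i) $T_{\rm p}\le T_1$, and $$\max_{k\in[m],\, i\in\{2,\dots,d\}}|w_k^i(T_{\rm p})|\le C\max\Big\{\frac{\log m}{m^{\alpha}},\ \frac{(\log m)^6}{m^{3}}\Big\};$$ (ii) $$\frac{|R(\theta(T_{\rm p}))-R(\theta(0))|}{T_{\rm p}}\le \frac{C}{m^{2\alpha_1-1}\log m}.$$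
   Context: Fix integers $d\ge2$ and $m\ge2$ (the width). For parameters $\theta=(a_k,w_k)_{k=1}^m$, $a_k\in\mathbb R$, $w_k=(w_k^1,\dots,w_k^d)^{T}\in\mathbb R^d$, the two-layer network is $f_\theta(x)=\sum_{k=1}^m a_k\sigma(w_k^{T}x)$ and the population risk is $R(\theta)=\tfrac12\int_{\mathbb R^d}(f_\theta(x)-f(x))^2\rho(x)\,dx$, where: $\rho$ is a probability density on $\mathbb R^d$ with compact support, $\int x_i^2\rho(x)dx=1$ for all $i\in[d]$ and $\int x_ix_j\rho(x)dx=0$ for $i\ne j$; $f:\mathbb R^d\to\mathbb R$ is bounded on the support of $\rho$ and $\int f(x)\,x\,\rho(x)dx=(1,0,\dots,0)^{T}$; $\sigma:\mathbb R\to\mathbb R$ is three times differentiable with $\sigma(0)=0$, $\sigma'(0)=1$, $\sigma''(0)=0$ and $|\sigma'''(z)|\le C_{\rm L}$ for all $z$. The initial parameters are independent with $a_k(0)\sim N(0,m^{-2\alpha})$ and $w_k(0)\sim N(0,m^{-2\alpha}I_d)$, and $\theta(t)$, $t\ge0$, solves the gradient flow $\frac{d\theta}{dt}=-\nabla_\theta R(\theta)$. Write $q_{\max}(t)=\max_{k\in[m],i\in[d]}\{|a_k(t)|,|w_k^i(t)|\}$. Define the linearized trajectories $\tilde a_k(t)=\tfrac12(a_k(0)+w_k^1(0))e^{t}+\tfrac12(a_k(0)-w_k^1(0))e^{-t}$, $\tilde w_k^1(t)=\tfrac12(a_k(0)+w_k^1(0))e^{t}-\tfrac12(a_k(0)-w_k^1(0))e^{-t}$,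 and $r_{\max}(t)=\max_{k\in[m]}\{|a_k(t)-\tilde a_k(t)|+|w_k^1(t)-\tilde w_k^1(t)|\}$. $\log$ is the natural logarithm. *)

theory Defs
  imports "HOL-Probability.Probability"
begin

text \<open>Inputs live in real^'d (d = CARD('d)); parameters: a :: nat => real,
  w :: nat => real^'d, only indices k < m are used.  The distinguished
  coordinate "1" of the paper is an arbitrary fixed index e1 :: 'd.\<close>

definition fnet :: "nat \<Rightarrow> (real \<Rightarrow> real) \<Rightarrow> (nat \<Rightarrow> real) \<Rightarrow> (nat \<Rightarrow> real^'d) \<Rightarrow> real^'d \<Rightarrow> real" where
  "fnet m \<sigma> a w x = (\<Sum>k<m. a k * \<sigma> (w k \<bullet> x))"

definition risk :: "nat \<Rightarrow> (real \<Rightarrow> real) \<Rightarrow> (real^'d \<Rightarrow> real) \<Rightarrow> (real^'d \<Rightarrow> real)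
    \<Rightarrow> (nat \<Rightarrow> real) \<Rightarrow> (nat \<Rightarrow> real^'d) \<Rightarrow> real" where
  "risk m \<sigma> f \<rho> a w = 1/2 * (LINT x|lborel. (fnet m \<sigma> a w x - f x)\<^sup>2 * \<rho> x)"

definition init_measure :: "nat \<Rightarrow> real \<Rightarrow> (nat \<Rightarrow> real \<times> (real^'d)) measure" where
  "init_measure m \<alpha> = PiM {..<m} (\<lambda>_. density lborel
      (\<lambda>(a, w). ennreal (normal_density 0 (real m powr (-\<alpha>)) a *
                 (\<Prod>i\<in>UNIV. normal_density 0 (real m powr (-\<alpha>)) (w $ i)))))"

definition grad_flow :: "nat \<Rightarrow> (real \<Rightarrow> real) \<Rightarrow> (real^'d \<Rightarrow> real) \<Rightarrow> (real^'d \<Rightarrow> real)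
    \<Rightarrow> (nat \<Rightarrow> real \<times> (real^'d)) \<Rightarrow> (real \<Rightarrow> nat \<Rightarrow> real) \<Rightarrow> (real \<Rightarrow> nat \<Rightarrow> real^'d) \<Rightarrow> bool" where
  "grad_flow m \<sigma> f \<rho> \<theta>0 a w \<longleftrightarrow>
     (\<forall>k<m. a 0 k = fst (\<theta>0 k) \<and> w 0 k = snd (\<theta>0 k)) \<and>
     (\<forall>t\<ge>0. \<forall>k<m.
        (\<exists>D. ((\<lambda>s. risk m \<sigma> f \<rho> ((a t)(k := s)) (w t)) has_real_derivative D) (at (a t k)) \<and>
             ((\<lambda>\<tau>. a \<tau> k) has_real_derivative (- D)) (at t within {0..})) \<and>
        (\<forall>i. \<exists>D. ((\<lambda>s. risk m \<sigma> f \<rho> (a t)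
                      ((w t)(k := (\<chi> j. if j = i then s else w t k $ j)))) has_real_derivative D) (at (w t k $ i)) \<and>
             ((\<lambda>\<tau>. w \<tau> k $ i) has_real_derivative (- D)) (at t within {0..})))"

definition qmax :: "nat \<Rightarrow> (real \<Rightarrow> nat \<Rightarrow> real) \<Rightarrow> (real \<Rightarrow> nat \<Rightarrow> real^'d) \<Rightarrow> real \<Rightarrow> real" where
  "qmax m a w t = Max ({\<bar>a t k\<bar> | k. k < m} \<union> {\<bar>w t k $ i\<bar> | k i. k < m})"

definition lin_a :: "real \<Rightarrow> real \<Rightarrow> real \<Rightarrow> real" where
  "lin_a a0 w0 t = (a0 + w0) / 2 * exp t + (a0 - w0) / 2 * exp (- t)"

definition lin_w :: "real \<Rightarrow> real \<Rightarrow> real \<Rightarrow> real" where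
  "lin_w a0 w0 t = (a0 + w0) / 2 * exp t - (a0 - w0) / 2 * exp (- t)"

definition rmax :: "nat \<Rightarrow> 'd \<Rightarrow> (real \<Rightarrow> nat \<Rightarrow> real) \<Rightarrow> (real \<Rightarrow> nat \<Rightarrow> real^'d) \<Rightarrow> real \<Rightarrow> real" where
  "rmax m e1 a w t = Max {\<bar>a t k - lin_a (a 0 k) (w 0 k $ e1) t\<bar>
                         + \<bar>w t k $ e1 - lin_w (a 0 k) (w 0 k $ e1) t\<bar> | k. k < m}"

definition alpha1 :: "real \<Rightarrow> real" where
  "alpha1 \<alpha> = (if \<alpha> \<le> 3/2 then \<alpha>/2 + 1/4 else 1)"

definition gamma1 :: "real \<Rightarrow> real" where
  "gamma1 \<alpha> = (if \<alpha> \<le> 3/2 then 3/2 * \<alpha> - 1/4 else 2)"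

definition Tp :: "real \<Rightarrow> nat \<Rightarrow> real" where
  "Tp \<alpha> m = (if \<alpha> \<le> 3/2 then (2 * \<alpha> - 1) / 4 * ln (real m) else (\<alpha> - 1) * ln (real m))"

text \<open>T_1 as an extended real (inf of the empty set is +infinity).\<close>
definition T1 :: "real \<Rightarrow> nat \<Rightarrow> 'd \<Rightarrow> (real \<Rightarrow> nat \<Rightarrow> real) \<Rightarrow> (real \<Rightarrow> nat \<Rightarrow> real^'d) \<Rightarrow> ereal" where
  "T1 \<alpha> m e1 a w = (INF t \<in> {t. t \<ge> 0 \<and>
        (qmax m a w t \<ge> real m powr (- alpha1 \<alpha>) * ln (real m) \<or>
         rmax m e1 a w t \<ge> real m powr (- gamma1 \<alpha>) * (ln (real m)) ^ 3)}. ereal t)"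

end

theory Submission
  imports Defs "HOL-Real_Asymp.Real_Asymp"
begin

text \<open>
  Write \<open>q\<^sub>k = a\<^sub>k\<^sup>2 + |w\<^sub>k|\<^sup>2\<close> and \<open>Q = \<Sum>\<^sub>k q\<^sub>k\<close>. While \<open>Q \<le> 1\<close>, Taylor expansion of the activation
  at \<open>0\<close> together with the moment conditions gives \<open>a\<^sub>k' = w\<^sub>k\<^sup>1 + O(Q |w\<^sub>k|)\<close> and
  \<open>w\<^sub>k' = a\<^sub>k e\<^sub>1 + O(Q |a\<^sub>k|)\<close>, hence \<open>q\<^sub>k' \<le> (2 + C Q) q\<^sub>k\<close>. A continuity argument then yields
  \<open>q\<^sub>k(t) \<le> 2 q\<^sub>k(0) e\<^sup>2\<^sup>t\<close> as long as \<open>Q(0) e\<^sup>2\<^sup>t\<close> is small, which holds up to \<open>T\<^sub>p\<close>. Integrating the error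
  terms along the linear flow bounds the remainder by \<open>Q(0) q\<^sub>m\<^sub>a\<^sub>x(0) e\<^sup>3\<^sup>t\<close>.

  At initialization \<open>Q(0) = O(m\<^sup>1\<^sup>-\<^sup>2\<^sup>\<alpha>)\<close> by Markov's inequality, without any logarithm, and every neuron
  has norm at most \<open>(log m) m\<^sup>-\<^sup>\<alpha> / 4\<close> by a Gaussian tail bound. Since the risk differs from its value at the
  zero network by \<open>O(Q)\<close>, the log-free bound on \<open>Q(0)\<close> is what gives (ii).
\<close>

section \<open>The Gaussian initialization\<close>

definition neuron_law :: "real \<Rightarrow> (real \<times> (real^'d)) measure" where
  "neuron_law s = density lborel
     (\<lambda>(a, w). ennreal (normal_density 0 s a * (\<Prod>i\<in>UNIV. normal_density 0 s (w $ i))))"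

lemma sets_neuron_law [measurable_cong, simp]: "sets (neuron_law s) = sets borel"
  by (simp add: neuron_law_def)

lemma space_neuron_law [simp]: "space (neuron_law s) = UNIV"
  by (simp add: neuron_law_def)

lemma prod_Basis_real_vec:
  fixes x :: "real \<times> (real^'d)" and h :: "real \<Rightarrow> 'b :: comm_monoid_mult"
  shows "(\<Prod>b\<in>Basis. h (x \<bullet> b)) = h (fst x) * (\<Prod>i\<in>UNIV. h (snd x $ i))"
proof -
  have Bvec: "(Basis :: (real^'d) set) = (\<lambda>i. axis i 1) ` UNIV"
    by (auto simp: Basis_vec_def)
  have "(\<Prod>b\<in>Basis. h (x \<bullet> b))
      = (\<Prod>b\<in>(\<lambda>u. (u, 0)) ` (Basis :: real set). h (x \<bullet> b))
        * (\<Prod>b\<in>(\<lambda>v. (0, v)) ` (Basis :: (real^'d) set). h (x \<bullet> b))"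
    unfolding Basis_prod_def by (rule prod.union_disjoint) auto
  also have "(\<Prod>b\<in>(\<lambda>v. (0, v)) ` (Basis :: (real^'d) set). h (x \<bullet> b))
      = (\<Prod>v\<in>(Basis :: (real^'d) set). h (snd x \<bullet> v))"
    by (subst prod.reindex) (auto simp: inj_on_def inner_prod_def)
  also have "\<dots> = (\<Prod>i\<in>UNIV. h (snd x $ i))"
    unfolding Bvec
    by (subst prod.reindex) (auto simp: inj_on_def axis_eq_axis cart_eq_inner_axis)
  finally show ?thesis
    by (simp add: inner_prod_def)
qed

lemma nn_integral_neuron_law:
  fixes b :: "real \<times> (real^'d)" and g :: "real \<Rightarrow> ennreal"
  assumes s: "s > 0" and b: "b \<in> Basis" and g [measurable]: "g \<in> borel_measurable borel"
  shows "(\<integral>\<^sup>+x. g (x \<bullet> b) \<partial>neuron_law s) = (\<integral>\<^sup>+y. ennreal (normal_density 0 s y) * g y \<partial>lborel)"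
proof -
  have dens: "(case x of (a, w) \<Rightarrow> ennreal (normal_density 0 s a * (\<Prod>i\<in>UNIV. normal_density 0 s (w $ i))))
      = (\<Prod>c\<in>Basis. ennreal (normal_density 0 s (x \<bullet> c)))" for x :: "real \<times> (real^'d)"
    by (subst prod_Basis_real_vec)
      (simp add: split_beta prod_ennreal ennreal_mult prod_nonneg)
  have mass: "(\<integral>\<^sup>+y. ennreal (normal_density 0 s y) \<partial>lborel) = 1"
    using s by (simp add: nn_integral_eq_integral)
  define F where "F = (\<lambda>c y. if c = b then ennreal (normal_density 0 s y) * g y
                              else ennreal (normal_density 0 s y))"
  have [measurable]: "F c \<in> borel_measurable borel" for c
    unfolding F_def by (cases "c = b") simp_all
  have "(\<integral>\<^sup>+x. g (x \<bullet> b) \<partial>neuron_law s)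
      = (\<integral>\<^sup>+x. (\<Prod>c\<in>Basis. ennreal (normal_density 0 s (x \<bullet> c))) * g (x \<bullet> b) \<partial>lborel)"
    unfolding neuron_law_def dens by (subst nn_integral_density) simp_all
  also have "\<dots> = (\<integral>\<^sup>+x. (\<Prod>c\<in>Basis. F c (x \<bullet> c)) \<partial>lborel)"
  proof (rule nn_integral_cong)
    fix x :: "real \<times> (real^'d)"
    show "(\<Prod>c\<in>Basis. ennreal (normal_density 0 s (x \<bullet> c))) * g (x \<bullet> b) = (\<Prod>c\<in>Basis. F c (x \<bullet> c))"
      by (subst (1 2) prod.remove[OF finite_Basis b])
        (auto simp: F_def mult_ac intro!: arg_cong2[where f="(*)"] prod.cong)
  qed
  also have "\<dots> = (\<Prod>c\<in>Basis. \<integral>\<^sup>+y. F c y \<partial>lborel)"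
    by (rule nn_integral_lborel_prod) simp_all
  also have "\<dots> = (\<integral>\<^sup>+y. F b y \<partial>lborel)"
    by (subst prod.remove[OF finite_Basis b]) (auto simp: F_def mass intro!: prod.neutral)
  finally show ?thesis by (simp add: F_def)
qed

lemma prob_space_neuron_law:
  assumes "s > 0" shows "prob_space (neuron_law s :: (real \<times> (real^'d)) measure)"
proof
  have "(\<integral>\<^sup>+x. 1 \<partial>(neuron_law s :: (real \<times> (real^'d)) measure)) = 1"
    using nn_integral_neuron_law[OF assms, of "SOME b. b \<in> Basis" "\<lambda>_. 1"] assms
    by (simp add: SOME_Basis nn_integral_eq_integral)
  then show "emeasure (neuron_law s :: (real \<times> (real^'d)) measure) (space (neuron_law s)) = 1"
    by simp
qed

lemma nn_integral_norm_sq_neuron_law: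
  fixes s :: real
  assumes s: "s > 0"
  shows "(\<integral>\<^sup>+x. ennreal ((norm x)\<^sup>2) \<partial>(neuron_law s :: (real \<times> (real^'d)) measure))
       = ennreal (DIM(real \<times> (real^'d)) * s\<^sup>2)"
proof -
  have moment: "(\<integral>\<^sup>+y. ennreal (normal_density 0 s y) * ennreal (y\<^sup>2) \<partial>lborel) = ennreal (s\<^sup>2)"
  proof -
    have "has_bochner_integral lborel (\<lambda>y. normal_density 0 s y * y\<^sup>2) (s\<^sup>2)"
      using normal_moment_even[OF s, of 0 1] by (simp add: power2_eq_square)
    then have "(\<integral>\<^sup>+y. ennreal (normal_density 0 s y * y\<^sup>2) \<partial>lborel) = ennreal (s\<^sup>2)"
      by (subst nn_integral_eq_integral) (auto simp: has_bochner_integral_iff)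
    then show ?thesis
      by (simp add: ennreal_mult)
  qed
  have "(\<integral>\<^sup>+x. ennreal ((norm x)\<^sup>2) \<partial>(neuron_law s :: (real \<times> (real^'d)) measure))
      = (\<integral>\<^sup>+x. (\<Sum>b\<in>Basis. ennreal ((x \<bullet> b)\<^sup>2)) \<partial>(neuron_law s :: (real \<times> (real^'d)) measure))"
    unfolding power2_norm_eq_inner
    by (subst euclidean_inner) (simp add: sum_ennreal power2_eq_square)
  also have "\<dots> = (\<Sum>b\<in>(Basis :: (real \<times> (real^'d)) set). \<integral>\<^sup>+x. ennreal ((x \<bullet> b)\<^sup>2) \<partial>neuron_law s)"
    by (rule nn_integral_sum) simp
  also have "\<dots> = (\<Sum>b\<in>(Basis :: (real \<times> (real^'d)) set). ennreal (s\<^sup>2))"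
    using nn_integral_neuron_law[OF s, of _ "\<lambda>y. ennreal (y\<^sup>2)"] moment by (intro sum.cong) simp_all
  finally show ?thesis
    by (simp add: sum_ennreal ennreal_mult ennreal_of_nat_eq_real_of_nat)
qed

lemma nn_integral_normal_exp:
  assumes s: "s > 0"
  shows "(\<integral>\<^sup>+y. ennreal (normal_density 0 s y) * ennreal (exp (l * y / s)) \<partial>lborel) = ennreal (exp (l\<^sup>2 / 2))"
proof -
  have "normal_density 0 s y * exp (l * y / s) = exp (l\<^sup>2 / 2) * normal_density (l * s) s y" for y
  proof -
    have "- (y\<^sup>2) / (2 * s\<^sup>2) + l * y / s = l\<^sup>2 / 2 + - ((y - l * s)\<^sup>2) / (2 * s\<^sup>2)"
      using s by (simp add: field_simps power2_eq_square)
    then have "exp (- (y\<^sup>2) / (2 * s\<^sup>2)) * exp (l * y / s) = exp (l\<^sup>2 / 2) * exp (- ((y - l * s)\<^sup>2) / (2 * s\<^sup>2))"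
      by (metis exp_add)
    then show ?thesis
      by (simp add: normal_density_def field_simps)
  qed
  then have "(\<integral>\<^sup>+y. ennreal (normal_density 0 s y) * ennreal (exp (l * y / s)) \<partial>lborel)
      = (\<integral>\<^sup>+y. ennreal (exp (l\<^sup>2 / 2)) * ennreal (normal_density (l * s) s y) \<partial>lborel)"
    by (intro nn_integral_cong) (simp add: ennreal_mult[symmetric])
  also have "\<dots> = ennreal (exp (l\<^sup>2 / 2))"
    using s by (simp add: nn_integral_cmult nn_integral_eq_integral)
  finally show ?thesis .
qed

lemma measure_neuron_law_tail:
  fixes b :: "real \<times> (real^'d)"
  assumes s: "s > 0" and b: "b \<in> Basis" and l: "l \<ge> 0"
  shows "measure (neuron_law s) {x. \<bar>x \<bullet> b\<bar> > z} \<le> 2 * exp (l\<^sup>2 / 2 - l * z / s)"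
proof -
  interpret prob_space "neuron_law s :: (real \<times> (real^'d)) measure"
    by (rule prob_space_neuron_law[OF s])
  have "emeasure (neuron_law s) {x. \<bar>x \<bullet> b\<bar> > z}
      = (\<integral>\<^sup>+x. indicator {y. \<bar>y\<bar> > z} (x \<bullet> b) \<partial>neuron_law s)"
  proof -
    have "(\<lambda>x. indicator {y. \<bar>y\<bar> > z} (x \<bullet> b)) = (indicator {x. \<bar>x \<bullet> b\<bar> > z} :: _ \<Rightarrow> ennreal)"
      by (auto split: split_indicator)
    then show ?thesis
      by simp
  qed
  also have "\<dots> = (\<integral>\<^sup>+y. ennreal (normal_density 0 s y) * indicator {y. \<bar>y\<bar> > z} y \<partial>lborel)"
    by (rule nn_integral_neuron_law[OF s b]) simp
  also have "\<dots> \<le> (\<integral>\<^sup>+y. ennreal (exp (- l * z / s)) *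
        (ennreal (normal_density 0 s y) * ennreal (exp (l * y / s))
         + ennreal (normal_density 0 s y) * ennreal (exp ((- l) * y / s))) \<partial>lborel)"
  proof (rule nn_integral_mono)
    fix y :: real
    have "1 \<le> exp (- l * z / s) * (exp (l * y / s) + exp ((- l) * y / s))" if "\<bar>y\<bar> > z"
    proof -
      have "l * z / s \<le> l * \<bar>y\<bar> / s"
        using that l s by (intro divide_right_mono mult_left_mono) auto
      then have "1 \<le> exp (- l * z / s) * exp (l * \<bar>y\<bar> / s)"
        by (simp add: exp_add[symmetric])
      also have "\<dots> \<le> exp (- l * z / s) * (exp (l * y / s) + exp ((- l) * y / s))"
        by (intro mult_left_mono) (cases "y \<ge> 0"; simp)+
      finally show ?thesis .
    qed
    then show "ennreal (normal_density 0 s y) * indicator {y. \<bar>y\<bar> > z} y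
        \<le> ennreal (exp (- l * z / s)) * (ennreal (normal_density 0 s y) * ennreal (exp (l * y / s))
           + ennreal (normal_density 0 s y) * ennreal (exp ((- l) * y / s)))"
      using mult_left_mono[of 1 "exp (- l * z / s) * (exp (l * y / s) + exp ((- l) * y / s))" "normal_density 0 s y"]
      by (simp add: ennreal_mult[symmetric] ennreal_plus[symmetric] algebra_simps
               del: ennreal_plus split: split_indicator)
  qed
  also have "\<dots> = ennreal (exp (- l * z / s)) * (ennreal (exp (l\<^sup>2 / 2)) + ennreal (exp (l\<^sup>2 / 2)))"
    using nn_integral_normal_exp[OF s, of l] nn_integral_normal_exp[OF s, of "- l"]
    by (subst nn_integral_cmult, simp, subst nn_integral_add) simp_all
  also have "\<dots> = ennreal (2 * exp (l\<^sup>2 / 2 - l * z / s))"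
    by (simp add: ennreal_mult[symmetric] ennreal_plus[symmetric] mult_exp_exp del: ennreal_plus)
  finally show ?thesis
    by (simp add: emeasure_eq_measure)
qed

lemma init_measure_eq: "init_measure m \<alpha> = PiM {..<m} (\<lambda>_. neuron_law (real m powr (- \<alpha>)))"
  by (simp add: init_measure_def neuron_law_def)

lemma init_measure_good_event:
  fixes m :: nat and \<alpha> B n l s D :: real
  defines "s \<equiv> real m powr (- \<alpha>)" and "D \<equiv> real DIM(real \<times> (real^'d))"
  assumes m: "m > 0" and B: "B > 0" and l: "l \<ge> 0"
  obtains E where "E \<in> sets (init_measure m \<alpha> :: (nat \<Rightarrow> real \<times> (real^'d)) measure)"
    and "measure (init_measure m \<alpha>) E \<ge> 1 - (D / B + 2 * m * D * exp (l\<^sup>2 / 2 - l * n / (D * s)))"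
    and "\<And>\<theta>. \<theta> \<in> E \<Longrightarrow> (\<Sum>k<m. (norm (\<theta> k))\<^sup>2) \<le> B * m * s\<^sup>2"
    and "\<And>\<theta> k. \<theta> \<in> E \<Longrightarrow> k < m \<Longrightarrow> norm (\<theta> k) \<le> n"
proof -
  define I where "I = (init_measure m \<alpha> :: (nat \<Rightarrow> real \<times> (real^'d)) measure)"
  have s: "s > 0" using m by (simp add: s_def)
  have D: "D > 0" by (simp add: D_def)
  note ps = prob_space_neuron_law[OF s]
  have I: "I = PiM {..<m} (\<lambda>_. neuron_law s)"
    by (simp add: I_def init_measure_eq s_def)
  interpret P: prob_space I
    unfolding I by (intro prob_space_PiM ps)
  have comp: "distr I (neuron_law s) (\<lambda>\<theta>. \<theta> k) = neuron_law s" if "k < m" for k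
    unfolding I using distr_PiM_component[of "{..<m}" "\<lambda>_. neuron_law s" k] that ps by simp
  have [measurable]: "(\<lambda>\<theta>. \<theta> k) \<in> measurable I borel" if "k < m" for k
    unfolding I using that measurable_component_singleton[of k "{..<m}" "\<lambda>_. neuron_law s"] by simp
  have [measurable]: "(\<lambda>\<theta>. \<theta> k) \<in> measurable I (neuron_law s)" if "k < m" for k
    unfolding I using that by simp
  have Qm [measurable]: "(\<lambda>\<theta>. \<Sum>k<m. (norm (\<theta> k))\<^sup>2) \<in> borel_measurable I"
    by (intro borel_measurable_sum) simp
  define F where "F = {\<theta> \<in> space I. (\<Sum>k<m. (norm (\<theta> k))\<^sup>2) \<ge> B * m * s\<^sup>2}"
  define G where "G = (\<lambda>(k, b). {\<theta> \<in> space I. \<bar>\<theta> k \<bullet> b\<bar> > n / D})"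
  define A where "A = {..<m} \<times> (Basis :: (real \<times> (real^'d)) set)"
  have F: "F \<in> P.events" unfolding F_def by simp
  have G: "G p \<in> P.events" if "p \<in> A" for p
    using that unfolding G_def A_def by auto
  have "P.prob F \<le> D / B"
  proof -
    have Q: "(\<integral>\<^sup>+\<theta>. ennreal (\<Sum>k<m. (norm (\<theta> k))\<^sup>2) \<partial>I) = ennreal (m * (D * s\<^sup>2))"
    proof -
      have "(\<integral>\<^sup>+\<theta>. ennreal (\<Sum>k<m. (norm (\<theta> k))\<^sup>2) \<partial>I) = (\<Sum>k<m. \<integral>\<^sup>+\<theta>. ennreal ((norm (\<theta> k))\<^sup>2) \<partial>I)"
        by (subst nn_integral_sum[symmetric]) (auto simp: sum_ennreal)
      also have "\<dots> = (\<Sum>k<m. \<integral>\<^sup>+x. ennreal ((norm x)\<^sup>2) \<partial>distr I (neuron_law s) (\<lambda>\<theta>. \<theta> k))"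
        by (intro sum.cong refl) (subst nn_integral_distr, auto simp: measurable_cong_sets[OF sets_neuron_law refl])
      also have "\<dots> = (\<Sum>k<m. ennreal (D * s\<^sup>2))"
        using nn_integral_norm_sq_neuron_law[OF s, where 'd='d] by (intro sum.cong refl) (simp add: comp D_def)
      finally show ?thesis
        using D by (simp add: sum_ennreal ennreal_mult ennreal_of_nat_eq_real_of_nat)
    qed
    have c: "B * m * s\<^sup>2 > 0" using B m s by simp
    have "emeasure I F \<le> ennreal (1 / (B * m * s\<^sup>2)) * (\<integral>\<^sup>+\<theta>. ennreal (\<Sum>k<m. (norm (\<theta> k))\<^sup>2) * indicator (space I) \<theta> \<partial>I)"
    proof -
      have "F = {\<theta> \<in> space I. 1 \<le> ennreal (1 / (B * m * s\<^sup>2)) * ennreal (\<Sum>k<m. (norm (\<theta> k))\<^sup>2)}"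
        unfolding F_def using c by (auto simp: ennreal_mult[symmetric] sum_nonneg field_simps)
      then show ?thesis
        using nn_integral_Markov_inequality[of "\<lambda>\<theta>. ennreal (\<Sum>k<m. (norm (\<theta> k))\<^sup>2)" "space I" I "ennreal (1 / (B * m * s\<^sup>2))"]
        by simp
    qed
    also have "(\<integral>\<^sup>+\<theta>. ennreal (\<Sum>k<m. (norm (\<theta> k))\<^sup>2) * indicator (space I) \<theta> \<partial>I) = ennreal (m * (D * s\<^sup>2))"
      unfolding Q[symmetric] by (intro nn_integral_cong) simp
    also have "ennreal (1 / (B * m * s\<^sup>2)) * ennreal (m * (D * s\<^sup>2)) = ennreal (D / B)"
      using B m s D by (simp add: ennreal_mult[symmetric])
    finally show ?thesis
      using D B by (simp add: P.emeasure_eq_measure)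
  qed
  moreover have "P.prob (\<Union>p\<in>A. G p) \<le> 2 * m * D * exp (l\<^sup>2 / 2 - l * n / (D * s))"
  proof -
    have "P.prob (\<Union>p\<in>A. G p) \<le> (\<Sum>p\<in>A. P.prob (G p))"
      using G by (intro P.finite_measure_subadditive_finite) (auto simp: A_def)
    also have "\<dots> \<le> (\<Sum>p\<in>A. 2 * exp (l\<^sup>2 / 2 - l * n / (D * s)))"
    proof (rule sum_mono)
      fix p assume p: "p \<in> A"
      obtain k b where kb: "p = (k, b)" "k < m" "b \<in> Basis"
        using p by (auto simp: A_def)
      have "P.prob (G p) = measure (distr I (neuron_law s) (\<lambda>\<theta>. \<theta> k)) {x. \<bar>x \<bullet> b\<bar> > n / D}"
        using kb by (subst measure_distr) (auto simp: G_def intro!: arg_cong[where f=P.prob])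
      also have "\<dots> \<le> 2 * exp (l\<^sup>2 / 2 - l * (n / D) / s)"
        unfolding comp[OF kb(2)] by (rule measure_neuron_law_tail[OF s kb(3) l])
      finally show "P.prob (G p) \<le> 2 * exp (l\<^sup>2 / 2 - l * n / (D * s))" by (simp add: field_simps)
    qed
    also have "\<dots> = 2 * m * D * exp (l\<^sup>2 / 2 - l * n / (D * s))"
      by (simp add: A_def D_def card_cartesian_product algebra_simps)
    finally show ?thesis .
  qed
  moreover have "P.prob (F \<union> (\<Union>p\<in>A. G p)) \<le> P.prob F + P.prob (\<Union>p\<in>A. G p)"
    using F G by (intro measure_Un_le sets.finite_UN) (auto simp: A_def)
  moreover have FG: "F \<union> (\<Union>p\<in>A. G p) \<in> P.events"
    using F G by (intro sets.Un sets.finite_UN) (auto simp: A_def)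
  ultimately have pr: "P.prob (space I - (F \<union> (\<Union>p\<in>A. G p)))
      \<ge> 1 - (D / B + 2 * m * D * exp (l\<^sup>2 / 2 - l * n / (D * s)))"
    using P.prob_compl[OF FG] by linarith
  show ?thesis
  proof (rule that[of "space I - (F \<union> (\<Union>p\<in>A. G p))"])
    show "space I - (F \<union> (\<Union>p\<in>A. G p)) \<in> sets (init_measure m \<alpha>)"
      using FG unfolding I_def by blast
    show "1 - (D / B + 2 * m * D * exp (l\<^sup>2 / 2 - l * n / (D * s)))
        \<le> measure (init_measure m \<alpha>) (space I - (F \<union> (\<Union>p\<in>A. G p)))"
      using pr unfolding I_def .
    fix \<theta> assume th: "\<theta> \<in> space I - (F \<union> (\<Union>p\<in>A. G p))"
    then show "(\<Sum>k<m. (norm (\<theta> k))\<^sup>2) \<le> B * m * s\<^sup>2"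
      by (auto simp: F_def)
    fix k assume k: "k < m"
    have "norm (\<theta> k) \<le> (\<Sum>b\<in>Basis. \<bar>\<theta> k \<bullet> b\<bar>)" by (rule norm_le_l1)
    also have "\<dots> \<le> (\<Sum>b\<in>(Basis :: (real \<times> (real^'d)) set). n / D)"
      using th k by (intro sum_mono) (force simp: A_def G_def not_less)
    also have "\<dots> = n" by (simp add: D_def)
    finally show "norm (\<theta> k) \<le> n" .
  qed
qed

section \<open>The population risk and its gradient\<close>

lemma abs_le_of_derivative_bound:
  fixes g g' :: "real \<Rightarrow> real"
  assumes "\<And>z. (g has_real_derivative g' z) (at z)" and "g 0 = 0"
    and "\<And>y. \<bar>y\<bar> \<le> \<bar>z\<bar> \<Longrightarrow> \<bar>g' y\<bar> \<le> c"
  shows "\<bar>g z\<bar> \<le> c * \<bar>z\<bar>"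
proof -
  have "norm (g z - g 0) \<le> c * norm (z - 0)"
    by (rule field_differentiable_bound[of "{-\<bar>z\<bar>..\<bar>z\<bar>}" g g' c])
      (use assms in \<open>auto intro: DERIV_subset\<close>)
  then show ?thesis using assms(2) by simp
qed

lemma (in finite_measure) has_real_derivative_integral:
  fixes F F' :: "real \<Rightarrow> 'a \<Rightarrow> real"
  assumes F [measurable]: "\<And>s. F s \<in> borel_measurable M" and F' [measurable]: "F' s0 \<in> borel_measurable M"
    and der: "AE x in M. \<forall>s\<in>ball s0 1. ((\<lambda>s. F s x) has_real_derivative F' s x) (at s) \<and> \<bar>F' s x\<bar> \<le> C"
    and bdd: "AE x in M. \<forall>s\<in>ball s0 1. \<bar>F s x\<bar> \<le> C"
  shows "((\<lambda>s. \<integral>x. F s x \<partial>M) has_real_derivative (\<integral>x. F' s0 x \<partial>M)) (at s0)"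
proof -
  have int: "integrable M (F s)" if "s \<in> ball s0 1" for s
    using bdd that by (intro integrable_const_bound[of _ C]) auto
  have "((\<lambda>s. ((\<integral>x. F s x \<partial>M) - (\<integral>x. F s0 x \<partial>M)) / (s - s0)) \<longlongrightarrow> (\<integral>x. F' s0 x \<partial>M)) (at s0 within ball s0 1)"
    unfolding tendsto_at_iff_sequentially
  proof (intro allI impI)
    fix X :: "nat \<Rightarrow> real"
    assume X: "\<forall>i. X i \<in> ball s0 1 - {s0}" and lim: "X \<longlonglongrightarrow> s0"
    have eq: "((\<integral>x. F (X i) x \<partial>M) - (\<integral>x. F s0 x \<partial>M)) / (X i - s0)
        = (\<integral>x. (F (X i) x - F s0 x) / (X i - s0) \<partial>M)" for i
      using X by (simp add: int Bochner_Integration.integral_diff)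
    have "(\<lambda>i. \<integral>x. (F (X i) x - F s0 x) / (X i - s0) \<partial>M) \<longlonglongrightarrow> (\<integral>x. F' s0 x \<partial>M)"
    proof (rule integral_dominated_convergence[where w="\<lambda>_. C"])
      show "AE x in M. (\<lambda>i. (F (X i) x - F s0 x) / (X i - s0)) \<longlonglongrightarrow> F' s0 x"
        using der
      proof eventually_elim
        case (elim x)
        then have "((\<lambda>s. (F s x - F s0 x) / (s - s0)) \<longlongrightarrow> F' s0 x) (at s0)"
          by (simp add: has_field_derivative_iff)
        then show ?case
          using X lim unfolding tendsto_at_iff_sequentially comp_def by blast
      qed
      show "AE x in M. norm ((F (X i) x - F s0 x) / (X i - s0)) \<le> C" for i
        using der
      proof eventually_elim
        case (elim x)
        have "norm (F (X i) x - F s0 x) \<le> C * norm (X i - s0)"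
          using elim X
          by (intro field_differentiable_bound[of "ball s0 1" "\<lambda>s. F s x" "\<lambda>s. F' s x"])
            (auto intro: has_field_derivative_at_within)
        then show ?case
          using X by (simp add: divide_simps)
      qed
    qed auto
    then show "((\<lambda>s. ((\<integral>x. F s x \<partial>M) - (\<integral>x. F s0 x \<partial>M)) / (s - s0)) \<circ> X) \<longlonglongrightarrow> (\<integral>x. F' s0 x \<partial>M)"
      by (simp add: comp_def eq)
  qed
  then show ?thesis
    using at_within_open[of s0 "ball s0 1"] by (simp add: has_field_derivative_iff)
qed

lemma (in prob_space) abs_integral_le_const:
  fixes g :: "'a \<Rightarrow> real"
  assumes g [measurable]: "g \<in> borel_measurable M" and bd: "AE x in M. \<bar>g x\<bar> \<le> c"
  shows "\<bar>\<integral>x. g x \<partial>M\<bar> \<le> c"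
proof -
  have int: "integrable M g"
    using bd by (intro integrable_const_bound[of _ c]) auto
  have "(\<integral>x. g x \<partial>M) \<le> c"
    using bd by (intro integral_le_const int) (auto elim: eventually_mono)
  moreover have "- c \<le> (\<integral>x. g x \<partial>M)"
    using bd by (intro integral_ge_const int) (auto elim: eventually_mono)
  ultimately show ?thesis by linarith
qed

definition neuron_sq :: "(nat \<Rightarrow> real) \<Rightarrow> (nat \<Rightarrow> real^'d) \<Rightarrow> nat \<Rightarrow> real" where
  "neuron_sq a w k = (a k)\<^sup>2 + (norm (w k))\<^sup>2"

definition total_sq :: "nat \<Rightarrow> (nat \<Rightarrow> real) \<Rightarrow> (nat \<Rightarrow> real^'d) \<Rightarrow> real" where
  "total_sq m a w = (\<Sum>k<m. neuron_sq a w k)"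

lemma neuron_sq_nonneg [simp]: "0 \<le> neuron_sq a w k"
  by (simp add: neuron_sq_def)

lemma total_sq_nonneg [simp]: "0 \<le> total_sq m a w"
  by (simp add: total_sq_def sum_nonneg)

lemma neuron_sq_le_total_sq: "k < m \<Longrightarrow> neuron_sq a w k \<le> total_sq m a w"
  unfolding total_sq_def by (rule member_le_sum) auto

lemma mult_le_neuron_sq: "2 * (\<bar>a k\<bar> * norm (w k)) \<le> neuron_sq a w k"
  using sum_squares_bound[of "\<bar>a k\<bar>" "norm (w k)"] by (simp add: neuron_sq_def)

locale two_layer = prob_space \<mu> for \<mu> :: "(real^'d) measure" +
  fixes f :: "real^'d \<Rightarrow> real" and \<sigma> \<sigma>1 \<sigma>2 \<sigma>3 :: "real \<Rightarrow> real"
    and e1 :: 'd and CL L B :: real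
  assumes sets_mu [measurable_cong]: "sets \<mu> = sets borel"
    and f_meas [measurable]: "f \<in> borel_measurable borel"
    and supp: "AE x in \<mu>. norm x \<le> L \<and> \<bar>f x\<bar> \<le> B"
    and L1: "L \<ge> 1" and B1: "B \<ge> 1"
    and mom: "\<And>i j. (\<integral>x. x $ i * x $ j \<partial>\<mu>) = (if i = j then 1 else 0)"
    and corr: "\<And>i. (\<integral>x. f x * x $ i \<partial>\<mu>) = (if i = e1 then 1 else 0)"
    and s1: "\<And>z. (\<sigma> has_real_derivative \<sigma>1 z) (at z)"
    and s2: "\<And>z. (\<sigma>1 has_real_derivative \<sigma>2 z) (at z)"
    and s3: "\<And>z. (\<sigma>2 has_real_derivative \<sigma>3 z) (at z)"
    and s0: "\<sigma> 0 = 0" "\<sigma>1 0 = 1" "\<sigma>2 0 = 0"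
    and sL: "\<And>z. \<bar>\<sigma>3 z\<bar> \<le> CL"
begin

lemma CL0: "CL \<ge> 0"
  using sL[of 0] by linarith

lemma abs_sigma2_le: "\<bar>\<sigma>2 z\<bar> \<le> CL * \<bar>z\<bar>"
  by (rule abs_le_of_derivative_bound[OF s3 s0(3) sL])

lemma abs_sigma1_diff_le: "\<bar>\<sigma>1 z - 1\<bar> \<le> CL * \<bar>z\<bar>\<^sup>2"
proof -
  have "\<bar>\<sigma>1 z - 1\<bar> \<le> CL * \<bar>z\<bar> * \<bar>z\<bar>"
  proof (rule abs_le_of_derivative_bound[of "\<lambda>z. \<sigma>1 z - 1" \<sigma>2])
    show "((\<lambda>z. \<sigma>1 z - 1) has_real_derivative \<sigma>2 z) (at z)" for z
      using s2[of z] by (auto intro!: derivative_eq_intros)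
    show "\<bar>\<sigma>2 y\<bar> \<le> CL * \<bar>z\<bar>" if "\<bar>y\<bar> \<le> \<bar>z\<bar>" for y
      using abs_sigma2_le[of y] mult_left_mono[OF that CL0] by linarith
  qed (simp add: s0)
  then show ?thesis by (simp add: power2_eq_square mult_ac)
qed

lemma abs_sigma_diff_le: "\<bar>\<sigma> z - z\<bar> \<le> CL * \<bar>z\<bar>^3"
proof -
  have "\<bar>\<sigma> z - z\<bar> \<le> CL * \<bar>z\<bar>\<^sup>2 * \<bar>z\<bar>"
  proof (rule abs_le_of_derivative_bound[of "\<lambda>z. \<sigma> z - z" "\<lambda>z. \<sigma>1 z - 1"])
    show "((\<lambda>z. \<sigma> z - z) has_real_derivative \<sigma>1 z - 1) (at z)" for z
      using s1[of z] by (auto intro!: derivative_eq_intros)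
    show "\<bar>\<sigma>1 y - 1\<bar> \<le> CL * \<bar>z\<bar>\<^sup>2" if "\<bar>y\<bar> \<le> \<bar>z\<bar>" for y
      using abs_sigma1_diff_le[of y] mult_left_mono[OF power_mono[OF that, of 2] CL0] by simp
  qed (simp add: s0)
  then show ?thesis by (simp add: power2_eq_square power3_eq_cube mult_ac)
qed

lemma abs_sigma1_le: "\<bar>z\<bar> \<le> Z \<Longrightarrow> \<bar>\<sigma>1 z\<bar> \<le> 1 + CL * Z\<^sup>2"
  using abs_sigma1_diff_le[of z] mult_left_mono[OF power_mono[of "\<bar>z\<bar>" Z 2] CL0] by auto

lemma abs_sigma_le: "\<bar>z\<bar> \<le> Z \<Longrightarrow> \<bar>\<sigma> z\<bar> \<le> (1 + CL * Z\<^sup>2) * Z"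
  using abs_sigma_diff_le[of z] mult_left_mono[OF power_mono[of "\<bar>z\<bar>" Z 3] CL0]
  by (auto simp: algebra_simps power2_eq_square power3_eq_cube)

lemma sigma_measurable [measurable]: "\<sigma> \<in> borel_measurable borel"
  using s1 by (intro borel_measurable_continuous_onI) (meson DERIV_isCont continuous_at_imp_continuous_on)

lemma sigma1_measurable [measurable]: "\<sigma>1 \<in> borel_measurable borel"
  using s2 by (intro borel_measurable_continuous_onI) (meson DERIV_isCont continuous_at_imp_continuous_on)

lemma fnet_measurable [measurable]: "fnet m \<sigma> a w \<in> borel_measurable borel"
  unfolding fnet_def by measurable

definition prisk :: "nat \<Rightarrow> (nat \<Rightarrow> real) \<Rightarrow> (nat \<Rightarrow> real^'d) \<Rightarrow> real" where
  "prisk m a w = 1/2 * (\<integral>x. (fnet m \<sigma> a w x - f x)\<^sup>2 \<partial>\<mu>)"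

definition grad_a :: "nat \<Rightarrow> (nat \<Rightarrow> real) \<Rightarrow> (nat \<Rightarrow> real^'d) \<Rightarrow> nat \<Rightarrow> real" where
  "grad_a m a w k = (\<integral>x. (fnet m \<sigma> a w x - f x) * \<sigma> (w k \<bullet> x) \<partial>\<mu>)"

definition grad_w :: "nat \<Rightarrow> (nat \<Rightarrow> real) \<Rightarrow> (nat \<Rightarrow> real^'d) \<Rightarrow> nat \<Rightarrow> 'd \<Rightarrow> real" where
  "grad_w m a w k i = (\<integral>x. (fnet m \<sigma> a w x - f x) * (a k * \<sigma>1 (w k \<bullet> x) * x $ i) \<partial>\<mu>)"

lemma half_square_loss_has_derivative:
  fixes N N' :: "real \<Rightarrow> real^'d \<Rightarrow> real"
  assumes [measurable]: "\<And>s. N s \<in> borel_measurable borel" "N' s0 \<in> borel_measurable borel"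
    and der: "\<And>s x. ((\<lambda>s. N s x) has_real_derivative N' s x) (at s)"
    and bdd: "\<And>s x. s \<in> ball s0 1 \<Longrightarrow> norm x \<le> L \<Longrightarrow> \<bar>N s x\<bar> \<le> C \<and> \<bar>N' s x\<bar> \<le> C"
  shows "((\<lambda>s. 1/2 * (\<integral>x. (N s x - f x)\<^sup>2 \<partial>\<mu>)) has_real_derivative
           (\<integral>x. (N s0 x - f x) * N' s0 x \<partial>\<mu>)) (at s0)"
proof -
  define C' where "C' = (C + B)\<^sup>2 + (C + B) * C"
  have "((\<lambda>s. \<integral>x. 1/2 * (N s x - f x)\<^sup>2 \<partial>\<mu>) has_real_derivative
           (\<integral>x. (N s0 x - f x) * N' s0 x \<partial>\<mu>)) (at s0)"
  proof (rule has_real_derivative_integral[where C=C'])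
    have *: "\<bar>(N s x - f x) * N' s x\<bar> \<le> C' \<and> \<bar>1/2 * (N s x - f x)\<^sup>2\<bar> \<le> C'"
      if "norm x \<le> L" "\<bar>f x\<bar> \<le> B" "s \<in> ball s0 1" for s x
    proof -
      have C: "\<bar>N s x\<bar> \<le> C" "\<bar>N' s x\<bar> \<le> C" using bdd that by auto
      then have C0: "0 \<le> C" by linarith
      have d: "\<bar>N s x - f x\<bar> \<le> C + B" using C(1) that(2) by linarith
      have "\<bar>(N s x - f x) * N' s x\<bar> \<le> (C + B) * C"
        unfolding abs_mult using d C C0 B1 by (intro mult_mono) auto
      moreover have "(N s x - f x)\<^sup>2 \<le> (C + B)\<^sup>2"
        using power_mono[OF d, of 2] by simp
      moreover have "0 \<le> (C + B) * C" using C0 B1 by simp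
      moreover have "0 \<le> (C + B)\<^sup>2" "0 \<le> (N s x - f x)\<^sup>2" by auto
      ultimately show ?thesis unfolding C'_def by linarith
    qed
    show "AE x in \<mu>. \<forall>s\<in>ball s0 1. ((\<lambda>s. 1/2 * (N s x - f x)\<^sup>2) has_real_derivative (N s x - f x) * N' s x) (at s)
            \<and> \<bar>(N s x - f x) * N' s x\<bar> \<le> C'"
      using supp
    proof eventually_elim
      case (elim x)
      show ?case
        using * elim by (auto intro!: derivative_eq_intros der)
    qed
    show "AE x in \<mu>. \<forall>s\<in>ball s0 1. \<bar>1/2 * (N s x - f x)\<^sup>2\<bar> \<le> C'"
      using supp by eventually_elim (use * in blast)
  qed measurable
  then show ?thesis by simp
qed

lemma fnet_upd_a:
  "k < m \<Longrightarrow> fnet m \<sigma> (a(k := s)) w x = fnet m \<sigma> a w x + (s - a k) * \<sigma> (w k \<bullet> x)"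
proof -
  assume k: "k < m"
  have "fnet m \<sigma> (a(k := s)) w x
      = (\<Sum>l<m. a l * \<sigma> (w l \<bullet> x) + (if l = k then (s - a k) * \<sigma> (w k \<bullet> x) else 0))"
    unfolding fnet_def by (intro sum.cong) (auto simp: algebra_simps)
  then show ?thesis
    using k by (simp add: sum.distrib fnet_def)
qed

lemma fnet_upd_w:
  "k < m \<Longrightarrow> fnet m \<sigma> a (w(k := v)) x = fnet m \<sigma> a w x + a k * (\<sigma> (v \<bullet> x) - \<sigma> (w k \<bullet> x))"
proof -
  assume k: "k < m"
  have "fnet m \<sigma> a (w(k := v)) x
      = (\<Sum>l<m. a l * \<sigma> (w l \<bullet> x) + (if l = k then a k * (\<sigma> (v \<bullet> x) - \<sigma> (w k \<bullet> x)) else 0))"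
    unfolding fnet_def by (intro sum.cong) (auto simp: algebra_simps)
  then show ?thesis
    using k by (simp add: sum.distrib fnet_def)
qed

lemma abs_inner_le: "norm x \<le> L \<Longrightarrow> \<bar>v \<bullet> x\<bar> \<le> L * norm v"
  using Cauchy_Schwarz_ineq2[of v x] mult_left_mono[of "norm x" L "norm v"] by (simp add: mult_ac)

lemma fnet_bounded:
  fixes w :: "nat \<Rightarrow> real^'d"
  shows "\<exists>C. \<forall>x. norm x \<le> L \<longrightarrow> \<bar>fnet m \<sigma> a w x\<bar> \<le> C"
proof (intro exI allI impI)
  fix x :: "real^'d" assume x: "norm x \<le> L"
  show "\<bar>fnet m \<sigma> a w x\<bar> \<le> (\<Sum>k<m. \<bar>a k\<bar> * ((1 + CL * (L * norm (w k))\<^sup>2) * (L * norm (w k))))"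
    unfolding fnet_def
    by (rule order_trans[OF sum_abs])
      (auto simp: abs_mult intro!: sum_mono mult_left_mono abs_sigma_le abs_inner_le x)
qed

lemma prisk_has_derivative_a:
  assumes k: "k < m"
  shows "((\<lambda>s. prisk m (a(k := s)) w) has_real_derivative grad_a m a w k) (at (a k))"
proof -
  obtain C where C: "\<And>x. norm x \<le> L \<Longrightarrow> \<bar>fnet m \<sigma> a w x\<bar> \<le> C"
    using fnet_bounded by blast
  define D where "D = (1 + CL * (L * norm (w k))\<^sup>2) * (L * norm (w k))"
  have D: "\<bar>\<sigma> (w k \<bullet> x)\<bar> \<le> D" if "norm x \<le> L" for x
    unfolding D_def by (intro abs_sigma_le abs_inner_le that)
  have "((\<lambda>s. 1/2 * (\<integral>x. (fnet m \<sigma> a w x + (s - a k) * \<sigma> (w k \<bullet> x) - f x)\<^sup>2 \<partial>\<mu>)) has_real_derivative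
           (\<integral>x. (fnet m \<sigma> a w x + (a k - a k) * \<sigma> (w k \<bullet> x) - f x) * \<sigma> (w k \<bullet> x) \<partial>\<mu>)) (at (a k))"
  proof (rule half_square_loss_has_derivative[where C="C + D"])
    fix s and x :: "real^'d" assume s: "s \<in> ball (a k) 1" and x: "norm x \<le> L"
    have "\<bar>s - a k\<bar> * \<bar>\<sigma> (w k \<bullet> x)\<bar> \<le> 1 * D"
      using s D[OF x] by (intro mult_mono) (auto simp: dist_real_def)
    then show "\<bar>fnet m \<sigma> a w x + (s - a k) * \<sigma> (w k \<bullet> x)\<bar> \<le> C + D \<and> \<bar>\<sigma> (w k \<bullet> x)\<bar> \<le> C + D"
      using C[OF x] D[OF x] by (auto simp: abs_mult[symmetric])
  qed (auto intro!: derivative_eq_intros)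
  then show ?thesis
    by (simp add: prisk_def grad_a_def fnet_upd_a[OF k])
qed

lemma prisk_has_derivative_w:
  assumes k: "k < m"
  shows "((\<lambda>s. prisk m a (w(k := (\<chi> j. if j = i then s else w k $ j)))) has_real_derivative grad_w m a w k i)
    (at (w k $ i))"
proof -
  define v where "v s = (\<chi> j. if j = i then s else w k $ j)" for s
  have v: "v s \<bullet> x = w k \<bullet> x + (s - w k $ i) * x $ i" for s x
  proof -
    have "v s \<bullet> x = (\<Sum>j\<in>UNIV. w k $ j * x $ j + (if j = i then (s - w k $ i) * x $ i else 0))"
      unfolding inner_vec_def v_def by (intro sum.cong) (auto simp: algebra_simps)
    then show ?thesis
      by (simp add: sum.distrib inner_vec_def)
  qed
  obtain C where C: "\<And>x. norm x \<le> L \<Longrightarrow> \<bar>fnet m \<sigma> a w x\<bar> \<le> C"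
    using fnet_bounded by blast
  define Z where "Z = L * norm (w k) + L"
  define D where "D = (1 + CL * Z\<^sup>2) * Z"
  define D' where "D' = (1 + CL * Z\<^sup>2) * L"
  have "((\<lambda>s. 1/2 * (\<integral>x. (fnet m \<sigma> a w x + a k * (\<sigma> (w k \<bullet> x + (s - w k $ i) * x $ i) - \<sigma> (w k \<bullet> x)) - f x)\<^sup>2 \<partial>\<mu>)) has_real_derivative
           (\<integral>x. (fnet m \<sigma> a w x + a k * (\<sigma> (w k \<bullet> x + (w k $ i - w k $ i) * x $ i) - \<sigma> (w k \<bullet> x)) - f x)
              * (a k * \<sigma>1 (w k \<bullet> x + (w k $ i - w k $ i) * x $ i) * x $ i) \<partial>\<mu>)) (at (w k $ i))"
  proof (rule half_square_loss_has_derivative[where C="C + \<bar>a k\<bar> * (D + D) + \<bar>a k\<bar> * D'"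
        and N="\<lambda>s x. fnet m \<sigma> a w x + a k * (\<sigma> (w k \<bullet> x + (s - w k $ i) * x $ i) - \<sigma> (w k \<bullet> x))"
        and N'="\<lambda>s x. a k * \<sigma>1 (w k \<bullet> x + (s - w k $ i) * x $ i) * x $ i"])
    fix s and x :: "real^'d" assume s: "s \<in> ball (w k $ i) 1" and x: "norm x \<le> L"
    have xi: "\<bar>x $ i\<bar> \<le> L" using component_le_norm_cart[of x i] x by linarith
    have "\<bar>s - w k $ i\<bar> * \<bar>x $ i\<bar> \<le> 1 * L"
      using s xi by (intro mult_mono) (auto simp: dist_real_def)
    then have z: "\<bar>w k \<bullet> x + (s - w k $ i) * x $ i\<bar> \<le> Z"
      using abs_inner_le[OF x, of "w k"] unfolding Z_def abs_mult[symmetric] by linarith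
    have z0: "\<bar>w k \<bullet> x\<bar> \<le> Z"
      using abs_inner_le[OF x, of "w k"] L1 unfolding Z_def by linarith
    have "\<bar>\<sigma> (w k \<bullet> x + (s - w k $ i) * x $ i) - \<sigma> (w k \<bullet> x)\<bar> \<le> D + D"
      using abs_sigma_le[OF z] abs_sigma_le[OF z0] unfolding D_def by linarith
    then have 1: "\<bar>a k * (\<sigma> (w k \<bullet> x + (s - w k $ i) * x $ i) - \<sigma> (w k \<bullet> x))\<bar> \<le> \<bar>a k\<bar> * (D + D)"
      unfolding abs_mult by (rule mult_left_mono) simp
    have "\<bar>\<sigma>1 (w k \<bullet> x + (s - w k $ i) * x $ i)\<bar> * \<bar>x $ i\<bar> \<le> D'"
      unfolding D'_def using abs_sigma1_le[OF z] xi CL0 by (intro mult_mono) auto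
    then have 2: "\<bar>a k * \<sigma>1 (w k \<bullet> x + (s - w k $ i) * x $ i) * x $ i\<bar> \<le> \<bar>a k\<bar> * D'"
      unfolding abs_mult mult.assoc by (rule mult_left_mono) simp
    show "\<bar>fnet m \<sigma> a w x + a k * (\<sigma> (w k \<bullet> x + (s - w k $ i) * x $ i) - \<sigma> (w k \<bullet> x))\<bar>
            \<le> C + \<bar>a k\<bar> * (D + D) + \<bar>a k\<bar> * D' \<and>
          \<bar>a k * \<sigma>1 (w k \<bullet> x + (s - w k $ i) * x $ i) * x $ i\<bar> \<le> C + \<bar>a k\<bar> * (D + D) + \<bar>a k\<bar> * D'"
      using 1 2 C[OF x] by linarith
  qed (auto intro!: derivative_eq_intros DERIV_chain2[OF s1])
  then show ?thesis
    by (simp add: prisk_def grad_w_def fnet_upd_w[OF k] v[unfolded v_def])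
qed

definition c1 :: real where "c1 = 1 + CL * L\<^sup>2"

definition K :: real where "K = 3 * B * L\<^sup>2 * c1\<^sup>2"

lemma c1_ge: "c1 \<ge> 1"
  using CL0 by (simp add: c1_def)

lemma K_bounds: "1 \<le> K" "B * c1 * L + L\<^sup>2 * c1\<^sup>2 + L\<^sup>2 * c1 \<le> K"
  "B * c1 * L + L\<^sup>2 * c1\<^sup>2 \<le> K" "L\<^sup>2 * c1\<^sup>2 + 2 * (B * c1 * L) \<le> 2 * K"
proof -
  have p: "1 \<le> L\<^sup>2" "1 \<le> c1\<^sup>2" "L \<le> L\<^sup>2" "c1 \<le> c1\<^sup>2"
    using L1 c1_ge self_le_power[of L 2] self_le_power[of c1 2] by (auto intro: one_le_power)
  have 1: "B * c1 * L \<le> B * c1\<^sup>2 * L\<^sup>2"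
    using p L1 B1 c1_ge by (intro mult_mono) auto
  have 2: "1 * (L\<^sup>2 * c1\<^sup>2) \<le> B * (L\<^sup>2 * c1\<^sup>2)"
    using B1 by (intro mult_right_mono) auto
  have 3: "L\<^sup>2 * c1 \<le> L\<^sup>2 * c1\<^sup>2"
    using p by (intro mult_left_mono) auto
  have "1 * 1 \<le> L\<^sup>2 * c1\<^sup>2" using p by (intro mult_mono) auto
  then show "1 \<le> K" using 2 by (simp add: K_def)
  show "B * c1 * L + L\<^sup>2 * c1\<^sup>2 + L\<^sup>2 * c1 \<le> K"
    using 1 2 3 by (simp add: K_def mult_ac)
  moreover have "0 \<le> L\<^sup>2 * c1" "0 \<le> L\<^sup>2 * c1\<^sup>2" using c1_ge by auto
  ultimately show "B * c1 * L + L\<^sup>2 * c1\<^sup>2 \<le> K" "L\<^sup>2 * c1\<^sup>2 + 2 * (B * c1 * L) \<le> 2 * K"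
    by linarith+
qed

lemma integrable_bounded:
  fixes g :: "real^'d \<Rightarrow> real" and C :: real
  assumes [measurable]: "g \<in> borel_measurable borel"
    and "\<And>x. norm x \<le> L \<Longrightarrow> \<bar>f x\<bar> \<le> B \<Longrightarrow> \<bar>g x\<bar> \<le> C"
  shows "integrable \<mu> g"
proof (rule integrable_const_bound[of _ C])
  show "AE x in \<mu>. norm (g x) \<le> C"
    using supp by eventually_elim (simp add: assms(2))
qed measurable

lemma abs_integral_le:
  fixes g :: "real^'d \<Rightarrow> real" and C :: real
  assumes [measurable]: "g \<in> borel_measurable borel"
    and "\<And>x. norm x \<le> L \<Longrightarrow> \<bar>f x\<bar> \<le> B \<Longrightarrow> \<bar>g x\<bar> \<le> C"
  shows "\<bar>\<integral>x. g x \<partial>\<mu>\<bar> \<le> C"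
proof (rule abs_integral_le_const)
  show "AE x in \<mu>. \<bar>g x\<bar> \<le> C"
    using supp by eventually_elim (simp add: assms(2))
qed measurable

lemma integral_linear_form:
  fixes h :: "real^'d \<Rightarrow> real" and C :: real
  assumes [measurable]: "h \<in> borel_measurable borel"
    and h: "\<And>x. norm x \<le> L \<Longrightarrow> \<bar>f x\<bar> \<le> B \<Longrightarrow> \<bar>h x\<bar> \<le> C"
  shows "(\<integral>x. h x * (v \<bullet> x) \<partial>\<mu>) = (\<Sum>j\<in>UNIV. v $ j * (\<integral>x. h x * x $ j \<partial>\<mu>))"
proof -
  have int: "integrable \<mu> (\<lambda>x. h x * x $ j)" for j
  proof (rule integrable_bounded[of _ "C * L"])
    fix x :: "real^'d" assume x: "norm x \<le> L" "\<bar>f x\<bar> \<le> B"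
    have "\<bar>x $ j\<bar> \<le> L" using component_le_norm_cart[of x j] x by linarith
    then show "\<bar>h x * x $ j\<bar> \<le> C * L"
      unfolding abs_mult using h[OF x] by (intro mult_mono) linarith+
  qed measurable
  have "(\<integral>x. h x * (v \<bullet> x) \<partial>\<mu>) = (\<integral>x. (\<Sum>j\<in>UNIV. v $ j * (h x * x $ j)) \<partial>\<mu>)"
    by (simp add: inner_vec_def sum_distrib_left mult_ac)
  then show ?thesis
    using int by simp
qed

lemma integral_f_linear: "(\<integral>x. f x * (v \<bullet> x) \<partial>\<mu>) = v $ e1"
  by (subst integral_linear_form[of f B]) (auto simp: corr sum.delta if_distrib cong: if_cong)

lemma integral_coord_linear: "(\<integral>x. x $ i * (v \<bullet> x) \<partial>\<mu>) = v $ i"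
proof -
  have "\<bar>x $ i\<bar> \<le> L" if "norm x \<le> L" for x :: "real^'d"
    using component_le_norm_cart[of x i] that by linarith
  then show ?thesis
    by (subst integral_linear_form[of _ L]) (auto simp: mom sum.delta if_distrib cong: if_cong)
qed

end

section \<open>Gradient estimates near the origin\<close>

context two_layer
begin

lemma activation_bounds:
  assumes x: "norm x \<le> L" and v: "norm v \<le> 1"
  shows "\<bar>\<sigma> (v \<bullet> x) - v \<bullet> x\<bar> \<le> c1 * L * norm v ^ 3" and "\<bar>\<sigma>1 (v \<bullet> x) - 1\<bar> \<le> c1 * (norm v)\<^sup>2"
    and "\<bar>\<sigma> (v \<bullet> x)\<bar> \<le> c1 * L * norm v" and "\<bar>\<sigma>1 (v \<bullet> x)\<bar> \<le> c1"
proof -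
  define r where "r = norm v"
  have r: "0 \<le> r" "r \<le> 1" using v by (auto simp: r_def)
  have z: "\<bar>v \<bullet> x\<bar> \<le> L * r" using abs_inner_le[OF x] by (simp add: r_def)
  have c: "CL * L\<^sup>2 \<le> c1" by (simp add: c1_def)
  have "\<bar>\<sigma> (v \<bullet> x) - v \<bullet> x\<bar> \<le> CL * (L * r)^3"
    using abs_sigma_diff_le[of "v \<bullet> x"] mult_left_mono[OF power_mono[OF z, of 3] CL0] by simp
  also have "\<dots> = (CL * L\<^sup>2) * (L * r^3)" by (simp add: power_mult_distrib power2_eq_square power3_eq_cube)
  also have "\<dots> \<le> c1 * (L * r^3)" using c r L1 by (intro mult_right_mono) auto
  finally show "\<bar>\<sigma> (v \<bullet> x) - v \<bullet> x\<bar> \<le> c1 * L * norm v ^ 3" by (simp add: r_def)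
  have "\<bar>\<sigma>1 (v \<bullet> x) - 1\<bar> \<le> CL * (L * r)\<^sup>2"
    using abs_sigma1_diff_le[of "v \<bullet> x"] mult_left_mono[OF power_mono[OF z, of 2] CL0] by simp
  also have "\<dots> = (CL * L\<^sup>2) * r\<^sup>2" by (simp add: power_mult_distrib)
  also have "\<dots> \<le> c1 * r\<^sup>2" using c by (intro mult_right_mono) auto
  finally show "\<bar>\<sigma>1 (v \<bullet> x) - 1\<bar> \<le> c1 * (norm v)\<^sup>2" by (simp add: r_def)
  have "(L * r)\<^sup>2 \<le> L\<^sup>2"
    using r L1 power_mono[of "L * r" L 2] by (simp add: mult_left_le)
  then have d: "1 + CL * (L * r)\<^sup>2 \<le> c1"
    using CL0 by (simp add: c1_def mult_left_mono)
  show "\<bar>\<sigma>1 (v \<bullet> x)\<bar> \<le> c1" using abs_sigma1_le[OF z] d by linarith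
  have "\<bar>\<sigma> (v \<bullet> x)\<bar> \<le> c1 * (L * r)"
    by (rule order_trans[OF abs_sigma_le[OF z] mult_right_mono[OF d]]) (use r L1 in simp)
  then show "\<bar>\<sigma> (v \<bullet> x)\<bar> \<le> c1 * L * norm v" by (simp add: r_def)
qed

lemma norm_w_le:
  fixes w :: "nat \<Rightarrow> real^'d"
  assumes "k < m"
  shows "(norm (w k))\<^sup>2 \<le> total_sq m a w"
  using neuron_sq_le_total_sq[OF assms, of a w] zero_le_power2[of "a k"]
  unfolding neuron_sq_def by linarith

lemma norm_w_le_1:
  fixes w :: "nat \<Rightarrow> real^'d"
  assumes "k < m" "total_sq m a w \<le> 1"
  shows "norm (w k) \<le> 1"
  using norm_w_le[OF assms(1), of w a] assms(2) abs_square_le_1[of "norm (w k)"] by simp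

lemma sum_abs_mult_norm_le: "(\<Sum>l<m. \<bar>a l\<bar> * norm (w l)) \<le> total_sq m a w"
  unfolding total_sq_def
proof (rule sum_mono)
  fix l
  show "\<bar>a l\<bar> * norm (w l) \<le> neuron_sq a w l"
    using mult_le_neuron_sq[of a l w] neuron_sq_nonneg[of a w l] by linarith
qed

lemma abs_fnet_le:
  fixes w :: "nat \<Rightarrow> real^'d"
  assumes Q: "total_sq m a w \<le> 1" and x: "norm x \<le> L"
  shows "\<bar>fnet m \<sigma> a w x\<bar> \<le> c1 * L * total_sq m a w"
proof -
  have "\<bar>fnet m \<sigma> a w x\<bar> \<le> (\<Sum>l<m. \<bar>a l * \<sigma> (w l \<bullet> x)\<bar>)"
    unfolding fnet_def by (rule sum_abs)
  also have "\<dots> \<le> (\<Sum>l<m. \<bar>a l\<bar> * (c1 * L * norm (w l)))"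
    unfolding abs_mult using norm_w_le_1[OF _ Q]
    by (intro sum_mono mult_left_mono activation_bounds(3)[OF x]) auto
  also have "\<dots> = c1 * L * (\<Sum>l<m. \<bar>a l\<bar> * norm (w l))"
    by (simp add: sum_distrib_left mult_ac)
  also have "\<dots> \<le> c1 * L * total_sq m a w"
    using c1_ge L1 by (intro mult_left_mono sum_abs_mult_norm_le) auto
  finally show ?thesis .
qed

lemma abs_coord_le: "norm (x :: real^'d) \<le> L \<Longrightarrow> \<bar>x $ i\<bar> \<le> L"
  using component_le_norm_cart[of x i] by linarith

lemma abs_fnet_diff_le:
  assumes Q: "total_sq m a w \<le> 1" and x: "norm x \<le> L" "\<bar>f x\<bar> \<le> B"
  shows "\<bar>fnet m \<sigma> a w x - f x\<bar> \<le> c1 * L + B"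
proof -
  have "c1 * L * total_sq m a w \<le> c1 * L"
    using Q c1_ge L1 by (simp add: mult_left_le)
  then show ?thesis using abs_fnet_le[OF Q x(1)] x(2) by linarith
qed

lemma grad_a_approx:
  assumes Q: "total_sq m a w \<le> 1" and k: "k < m"
  shows "\<bar>- grad_a m a w k - w k $ e1\<bar> \<le> K * total_sq m a w * norm (w k)"
proof -
  let ?Q = "total_sq m a w" and ?r = "norm (w k)"
  note w1 = norm_w_le_1[OF k Q]
  have pos: "0 \<le> c1" "0 \<le> L" "0 \<le> B" using c1_ge L1 B1 by auto
  have int1: "integrable \<mu> (\<lambda>x. (fnet m \<sigma> a w x - f x) * \<sigma> (w k \<bullet> x))"
  proof (rule integrable_bounded)
    fix x :: "real^'d" assume x: "norm x \<le> L" "\<bar>f x\<bar> \<le> B"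
    show "\<bar>(fnet m \<sigma> a w x - f x) * \<sigma> (w k \<bullet> x)\<bar> \<le> (c1 * L + B) * (c1 * L * ?r)"
      unfolding abs_mult
      using abs_fnet_diff_le[OF Q x] activation_bounds(3)[OF x(1) w1] pos by (intro mult_mono) auto
  qed measurable
  have int2: "integrable \<mu> (\<lambda>x. f x * (w k \<bullet> x))"
  proof (rule integrable_bounded)
    fix x :: "real^'d" assume x: "norm x \<le> L" "\<bar>f x\<bar> \<le> B"
    show "\<bar>f x * (w k \<bullet> x)\<bar> \<le> B * (L * ?r)"
      unfolding abs_mult using x abs_inner_le[OF x(1), of "w k"] pos by (intro mult_mono) auto
  qed measurable
  have "- grad_a m a w k - w k $ e1
      = - (\<integral>x. (fnet m \<sigma> a w x - f x) * \<sigma> (w k \<bullet> x) + f x * (w k \<bullet> x) \<partial>\<mu>)"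
    unfolding grad_a_def Bochner_Integration.integral_add[OF int1 int2] integral_f_linear by simp
  moreover have "\<bar>\<integral>x. (fnet m \<sigma> a w x - f x) * \<sigma> (w k \<bullet> x) + f x * (w k \<bullet> x) \<partial>\<mu>\<bar> \<le> K * ?Q * ?r"
  proof (rule abs_integral_le)
    fix x :: "real^'d" assume x: "norm x \<le> L" "\<bar>f x\<bar> \<le> B"
    let ?s = "\<sigma> (w k \<bullet> x)" and ?z = "w k \<bullet> x"
    have "\<bar>f x * (?s - ?z)\<bar> \<le> B * (c1 * L * ?r ^ 3)"
      unfolding abs_mult using x activation_bounds(1)[OF x(1) w1] pos by (intro mult_mono) auto
    also have "\<dots> = (B * c1 * L) * (?r\<^sup>2 * ?r)" by (simp add: power2_eq_square power3_eq_cube)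
    also have "\<dots> \<le> (B * c1 * L) * (?Q * ?r)"
      using pos norm_w_le[OF k, of w a] by (intro mult_left_mono mult_right_mono) auto
    finally have 1: "\<bar>f x * (?s - ?z)\<bar> \<le> (B * c1 * L) * (?Q * ?r)" .
    have "\<bar>fnet m \<sigma> a w x * ?s\<bar> \<le> (c1 * L * ?Q) * (c1 * L * ?r)"
      unfolding abs_mult using abs_fnet_le[OF Q x(1)] activation_bounds(3)[OF x(1) w1] pos
      by (intro mult_mono) auto
    also have "\<dots> = (L\<^sup>2 * c1\<^sup>2) * (?Q * ?r)" by (simp add: power2_eq_square)
    finally have 2: "\<bar>fnet m \<sigma> a w x * ?s\<bar> \<le> (L\<^sup>2 * c1\<^sup>2) * (?Q * ?r)" .
    have "(fnet m \<sigma> a w x - f x) * ?s + f x * ?z = fnet m \<sigma> a w x * ?s - f x * (?s - ?z)"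
      by (simp add: algebra_simps)
    then have "\<bar>(fnet m \<sigma> a w x - f x) * ?s + f x * ?z\<bar> \<le> (B * c1 * L + L\<^sup>2 * c1\<^sup>2) * (?Q * ?r)"
      using 1 2 unfolding distrib_right by linarith
    also have "\<dots> \<le> K * (?Q * ?r)"
      using K_bounds(3) by (intro mult_right_mono) auto
    finally show "\<bar>(fnet m \<sigma> a w x - f x) * ?s + f x * ?z\<bar> \<le> K * ?Q * ?r" by (simp add: mult_ac)
  qed measurable
  ultimately show ?thesis by simp
qed

lemma integrable_grad_w:
  assumes Q: "total_sq m a w \<le> 1" and k: "k < m"
  shows "integrable \<mu> (\<lambda>x. (fnet m \<sigma> a w x - f x) * (a k * \<sigma>1 (w k \<bullet> x) * x $ i))"
proof (rule integrable_bounded)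
  have pos: "0 \<le> c1" "0 \<le> L" "0 \<le> B" using c1_ge L1 B1 by auto
  fix x :: "real^'d" assume x: "norm x \<le> L" "\<bar>f x\<bar> \<le> B"
  show "\<bar>(fnet m \<sigma> a w x - f x) * (a k * \<sigma>1 (w k \<bullet> x) * x $ i)\<bar> \<le> (c1 * L + B) * (\<bar>a k\<bar> * c1 * L)"
    unfolding abs_mult
    using abs_fnet_diff_le[OF Q x] activation_bounds(4)[OF x(1) norm_w_le_1[OF k Q]] abs_coord_le[OF x(1), of i] pos
    by (intro mult_mono) auto
qed measurable

lemma grad_w_approx:
  assumes Q: "total_sq m a w \<le> 1" and k: "k < m"
  shows "\<bar>- grad_w m a w k i - (if i = e1 then a k else 0)\<bar> \<le> K * total_sq m a w * \<bar>a k\<bar>"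
proof -
  let ?Q = "total_sq m a w" and ?r = "norm (w k)"
  note w1 = norm_w_le_1[OF k Q]
  have pos: "0 \<le> c1" "0 \<le> L" "0 \<le> B" using c1_ge L1 B1 by auto
  note int1 = integrable_grad_w[OF Q k, of i]
  have int2: "integrable \<mu> (\<lambda>x. f x * x $ i)"
  proof (rule integrable_bounded)
    fix x :: "real^'d" assume x: "norm x \<le> L" "\<bar>f x\<bar> \<le> B"
    show "\<bar>f x * x $ i\<bar> \<le> B * L"
      unfolding abs_mult using x abs_coord_le[OF x(1), of i] pos by (intro mult_mono) auto
  qed measurable
  have "- grad_w m a w k i - (if i = e1 then a k else 0)
      = - (\<integral>x. (fnet m \<sigma> a w x - f x) * (a k * \<sigma>1 (w k \<bullet> x) * x $ i) + a k * (f x * x $ i) \<partial>\<mu>)"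
    by (subst Bochner_Integration.integral_add[OF int1 integrable_mult_right[OF int2]])
      (simp add: grad_w_def corr)
  moreover have "\<bar>\<integral>x. (fnet m \<sigma> a w x - f x) * (a k * \<sigma>1 (w k \<bullet> x) * x $ i) + a k * (f x * x $ i) \<partial>\<mu>\<bar> \<le> K * ?Q * \<bar>a k\<bar>"
  proof (rule abs_integral_le)
    fix x :: "real^'d" assume x: "norm x \<le> L" "\<bar>f x\<bar> \<le> B"
    let ?s = "\<sigma>1 (w k \<bullet> x)" and ?F = "fnet m \<sigma> a w x"
    have "\<bar>f x * (?s - 1) * x $ i\<bar> \<le> B * (c1 * ?r\<^sup>2) * L"
      unfolding abs_mult using x activation_bounds(2)[OF x(1) w1] abs_coord_le[OF x(1), of i] pos
      by (intro mult_mono) auto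
    also have "\<dots> = (B * c1 * L) * ?r\<^sup>2" by simp
    also have "\<dots> \<le> (B * c1 * L) * ?Q"
      using pos norm_w_le[OF k, of w a] by (intro mult_left_mono) auto
    finally have 1: "\<bar>f x * (?s - 1) * x $ i\<bar> \<le> (B * c1 * L) * ?Q" .
    have "\<bar>?F * ?s * x $ i\<bar> \<le> (c1 * L * ?Q) * c1 * L"
      unfolding abs_mult using abs_fnet_le[OF Q x(1)] activation_bounds(4)[OF x(1) w1] abs_coord_le[OF x(1), of i] pos
      by (intro mult_mono) auto
    also have "\<dots> = (L\<^sup>2 * c1\<^sup>2) * ?Q" by (simp add: power2_eq_square)
    finally have 2: "\<bar>?F * ?s * x $ i\<bar> \<le> (L\<^sup>2 * c1\<^sup>2) * ?Q" .
    have "\<bar>?F * ?s * x $ i - f x * (?s - 1) * x $ i\<bar> \<le> (B * c1 * L + L\<^sup>2 * c1\<^sup>2) * ?Q"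
      using 1 2 unfolding distrib_right by linarith
    also have "\<dots> \<le> K * ?Q"
      using K_bounds(3) by (intro mult_right_mono) auto
    finally have "\<bar>a k\<bar> * \<bar>?F * ?s * x $ i - f x * (?s - 1) * x $ i\<bar> \<le> \<bar>a k\<bar> * (K * ?Q)"
      by (rule mult_left_mono) simp
    then show "\<bar>(?F - f x) * (a k * ?s * x $ i) + a k * (f x * x $ i)\<bar> \<le> K * ?Q * \<bar>a k\<bar>"
      unfolding abs_mult[symmetric] by (simp add: algebra_simps)
  qed measurable
  ultimately show ?thesis by simp
qed

text \<open>In the directions orthogonal to the signal the linear part of the network contributes
  only through the (small) orthogonal weights themselves; this is what improves the drift from
  order \<open>m N\<^sup>3\<close> to order \<open>N\<^sup>3\<close> when all parameters are at most \<open>N\<close>.\<close>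

lemma grad_w_orthogonal:
  assumes Q: "total_sq m a w \<le> 1" and k: "k < m" and i: "i \<noteq> e1"
    and N: "\<And>l. l < m \<Longrightarrow> norm (w l) \<le> N"
  shows "\<bar>grad_w m a w k i\<bar> \<le> \<bar>a k\<bar> * (\<bar>\<Sum>l<m. a l * w l $ i\<bar> + K * N\<^sup>2)"
proof -
  let ?Q = "total_sq m a w"
  define v where "v = (\<Sum>l<m. a l *\<^sub>R w l)"
  have vi: "v $ i = (\<Sum>l<m. a l * w l $ i)" by (simp add: v_def)
  note w1 = norm_w_le_1[OF k Q]
  have pos: "0 \<le> c1" "0 \<le> L" "0 \<le> B" using c1_ge L1 B1 by auto
  have N0: "0 \<le> N" using N[OF k] norm_ge_zero[of "w k"] by linarith
  note int1 = integrable_grad_w[OF Q k, of i]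
  have int2: "integrable \<mu> (\<lambda>x. x $ i * (v \<bullet> x))"
  proof (rule integrable_bounded)
    fix x :: "real^'d" assume x: "norm x \<le> L" "\<bar>f x\<bar> \<le> B"
    show "\<bar>x $ i * (v \<bullet> x)\<bar> \<le> L * (L * norm v)"
      unfolding abs_mult using abs_inner_le[OF x(1), of v] abs_coord_le[OF x(1), of i] pos by (intro mult_mono) auto
  qed measurable
  have int3: "integrable \<mu> (\<lambda>x. f x * x $ i)"
  proof (rule integrable_bounded)
    fix x :: "real^'d" assume x: "norm x \<le> L" "\<bar>f x\<bar> \<le> B"
    show "\<bar>f x * x $ i\<bar> \<le> B * L"
      unfolding abs_mult using x abs_coord_le[OF x(1), of i] pos by (intro mult_mono) auto
  qed measurable
  have "grad_w m a w k i - a k * v $ i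
      = (\<integral>x. (fnet m \<sigma> a w x - f x) * (a k * \<sigma>1 (w k \<bullet> x) * x $ i) - a k * (x $ i * (v \<bullet> x) - f x * x $ i) \<partial>\<mu>)"
    using i int1 int2 int3 by (simp add: grad_w_def corr integral_coord_linear)
  moreover have "\<bar>\<integral>x. (fnet m \<sigma> a w x - f x) * (a k * \<sigma>1 (w k \<bullet> x) * x $ i) - a k * (x $ i * (v \<bullet> x) - f x * x $ i) \<partial>\<mu>\<bar>
      \<le> \<bar>a k\<bar> * (K * N\<^sup>2)"
  proof (rule abs_integral_le)
    fix x :: "real^'d" assume x: "norm x \<le> L" "\<bar>f x\<bar> \<le> B"
    let ?s = "\<sigma>1 (w k \<bullet> x)" and ?F = "fnet m \<sigma> a w x"
    note xi = abs_coord_le[OF x(1), of i]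
    have s1: "\<bar>?s - 1\<bar> \<le> c1 * N\<^sup>2"
      using activation_bounds(2)[OF x(1) w1] mult_left_mono[OF power_mono[OF N[OF k] norm_ge_zero, of 2] pos(1)] by linarith
    have F1: "\<bar>?F\<bar> \<le> c1 * L"
      using abs_fnet_le[OF Q x(1)] mult_left_le[of ?Q "c1 * L"] Q pos by auto
    have "\<bar>f x * (?s - 1) * x $ i\<bar> \<le> B * (c1 * N\<^sup>2) * L"
      unfolding abs_mult using x s1 xi pos by (intro mult_mono) auto
    then have 1: "\<bar>f x * (?s - 1) * x $ i\<bar> \<le> (B * c1 * L) * N\<^sup>2" by (simp add: mult_ac)
    have "\<bar>?F * (?s - 1) * x $ i\<bar> \<le> (c1 * L) * (c1 * N\<^sup>2) * L"
      unfolding abs_mult using F1 s1 xi pos by (intro mult_mono) auto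
    then have 2: "\<bar>?F * (?s - 1) * x $ i\<bar> \<le> (L\<^sup>2 * c1\<^sup>2) * N\<^sup>2" by (simp add: power2_eq_square mult_ac)
    have "\<bar>?F - v \<bullet> x\<bar> \<le> c1 * L * N\<^sup>2"
    proof -
      have "?F - v \<bullet> x = (\<Sum>l<m. a l * (\<sigma> (w l \<bullet> x) - w l \<bullet> x))"
        by (simp add: fnet_def v_def inner_sum_left algebra_simps sum_subtractf)
      also have "\<bar>\<dots>\<bar> \<le> (\<Sum>l<m. \<bar>a l * (\<sigma> (w l \<bullet> x) - w l \<bullet> x)\<bar>)" by (rule sum_abs)
      also have "\<dots> \<le> (\<Sum>l<m. c1 * L * N\<^sup>2 * (\<bar>a l\<bar> * norm (w l)))"
      proof (rule sum_mono)
        fix l assume "l \<in> {..<m}"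
        then have l: "l < m" by simp
        have "\<bar>\<sigma> (w l \<bullet> x) - w l \<bullet> x\<bar> \<le> c1 * L * norm (w l) ^ 3"
          by (rule activation_bounds(1)[OF x(1) norm_w_le_1[OF l Q]])
        also have "\<dots> = c1 * L * norm (w l) * (norm (w l))\<^sup>2" by (simp add: power2_eq_square power3_eq_cube)
        also have "\<dots> \<le> c1 * L * norm (w l) * N\<^sup>2"
          using pos N[OF l] by (intro mult_left_mono power_mono) auto
        finally have "\<bar>a l\<bar> * \<bar>\<sigma> (w l \<bullet> x) - w l \<bullet> x\<bar> \<le> \<bar>a l\<bar> * (c1 * L * norm (w l) * N\<^sup>2)"
          by (rule mult_left_mono) simp
        then show "\<bar>a l * (\<sigma> (w l \<bullet> x) - w l \<bullet> x)\<bar> \<le> c1 * L * N\<^sup>2 * (\<bar>a l\<bar> * norm (w l))"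
          unfolding abs_mult by (simp add: mult_ac)
      qed
      also have "\<dots> = c1 * L * N\<^sup>2 * (\<Sum>l<m. \<bar>a l\<bar> * norm (w l))" by (simp add: sum_distrib_left)
      also have "\<dots> \<le> c1 * L * N\<^sup>2"
        using pos Q sum_abs_mult_norm_le[of a w m] by (intro mult_left_le) auto
      finally show ?thesis .
    qed
    then have "\<bar>(?F - v \<bullet> x) * x $ i\<bar> \<le> (c1 * L * N\<^sup>2) * L"
      unfolding abs_mult using xi pos by (intro mult_mono) auto
    then have 3: "\<bar>(?F - v \<bullet> x) * x $ i\<bar> \<le> (L\<^sup>2 * c1) * N\<^sup>2" by (simp add: power2_eq_square mult_ac)
    have "\<bar>?F * (?s - 1) * x $ i - f x * (?s - 1) * x $ i + (?F - v \<bullet> x) * x $ i\<bar>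
        \<le> (B * c1 * L + L\<^sup>2 * c1\<^sup>2 + L\<^sup>2 * c1) * N\<^sup>2"
      using 1 2 3 unfolding distrib_right by linarith
    also have "\<dots> \<le> K * N\<^sup>2"
      using K_bounds(2) by (intro mult_right_mono) auto
    finally have "\<bar>a k\<bar> * \<bar>?F * (?s - 1) * x $ i - f x * (?s - 1) * x $ i + (?F - v \<bullet> x) * x $ i\<bar> \<le> \<bar>a k\<bar> * (K * N\<^sup>2)"
      by (rule mult_left_mono) simp
    then show "\<bar>(?F - f x) * (a k * ?s * x $ i) - a k * (x $ i * (v \<bullet> x) - f x * x $ i)\<bar> \<le> \<bar>a k\<bar> * (K * N\<^sup>2)"
      unfolding abs_mult[symmetric] by (simp add: algebra_simps)
  qed measurable
  ultimately have "\<bar>grad_w m a w k i - a k * v $ i\<bar> \<le> \<bar>a k\<bar> * (K * N\<^sup>2)" by simp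
  then show ?thesis
    unfolding vi distrib_left abs_mult[symmetric] by linarith
qed

lemma prisk_near_zero:
  assumes Q: "total_sq m a w \<le> 1"
  shows "\<bar>prisk m a w - 1/2 * (\<integral>x. (f x)\<^sup>2 \<partial>\<mu>)\<bar> \<le> K * total_sq m a w"
proof -
  let ?Q = "total_sq m a w"
  have pos: "0 \<le> c1" "0 \<le> L" "0 \<le> B" using c1_ge L1 B1 by auto
  have int1: "integrable \<mu> (\<lambda>x. (fnet m \<sigma> a w x - f x)\<^sup>2)"
  proof (rule integrable_bounded)
    fix x :: "real^'d" assume x: "norm x \<le> L" "\<bar>f x\<bar> \<le> B"
    show "\<bar>(fnet m \<sigma> a w x - f x)\<^sup>2\<bar> \<le> (c1 * L + B)\<^sup>2"
      using power_mono[OF abs_fnet_diff_le[OF Q x], of 2] by simp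
  qed measurable
  have int2: "integrable \<mu> (\<lambda>x. (f x)\<^sup>2)"
  proof (rule integrable_bounded)
    fix x :: "real^'d" assume x: "norm x \<le> L" "\<bar>f x\<bar> \<le> B"
    show "\<bar>(f x)\<^sup>2\<bar> \<le> B\<^sup>2" using power_mono[OF x(2), of 2] by simp
  qed measurable
  have "prisk m a w - 1/2 * (\<integral>x. (f x)\<^sup>2 \<partial>\<mu>) = 1/2 * (\<integral>x. (fnet m \<sigma> a w x - f x)\<^sup>2 - (f x)\<^sup>2 \<partial>\<mu>)"
    using int1 int2 by (simp add: prisk_def algebra_simps)
  moreover have "\<bar>\<integral>x. (fnet m \<sigma> a w x - f x)\<^sup>2 - (f x)\<^sup>2 \<partial>\<mu>\<bar> \<le> 2 * (K * ?Q)"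
  proof (rule abs_integral_le)
    fix x :: "real^'d" assume x: "norm x \<le> L" "\<bar>f x\<bar> \<le> B"
    let ?F = "fnet m \<sigma> a w x"
    note F = abs_fnet_le[OF Q x(1)]
    have "\<bar>?F\<bar> \<le> c1 * L"
      using F mult_left_le[of ?Q "c1 * L"] Q pos by auto
    then have "\<bar>?F - 2 * f x\<bar> \<le> c1 * L + 2 * B" using x(2) by linarith
    then have "\<bar>?F * (?F - 2 * f x)\<bar> \<le> (c1 * L * ?Q) * (c1 * L + 2 * B)"
      unfolding abs_mult using F pos by (intro mult_mono) auto
    also have "\<dots> = (L\<^sup>2 * c1\<^sup>2 + 2 * (B * c1 * L)) * ?Q" by (simp add: algebra_simps power2_eq_square)
    also have "\<dots> \<le> (2 * K) * ?Q"
      using K_bounds(4) by (intro mult_right_mono) auto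
    finally show "\<bar>(?F - f x)\<^sup>2 - (f x)\<^sup>2\<bar> \<le> 2 * (K * ?Q)"
      by (simp add: power2_eq_square algebra_simps)
  qed measurable
  ultimately show ?thesis by (simp add: abs_mult)
qed

end

section \<open>The gradient flow up to the linearization time\<close>

lemma gronwall_exp:
  fixes y g g' :: "real \<Rightarrow> real"
  assumes T: "0 \<le> T" and y: "continuous_on {0..T} y"
    and g: "\<And>t. (g has_real_derivative g' t) (at t)"
    and y': "\<And>t. 0 < t \<Longrightarrow> t < T \<Longrightarrow> \<exists>D. (y has_real_derivative D) (at t) \<and> D \<le> g' t * y t"
  shows "y T \<le> y 0 * exp (g T - g 0)"
proof -
  have gc: "continuous_on {0..T} g"
    using g by (meson DERIV_isCont continuous_at_imp_continuous_on)
  have "y T * exp (- g T) \<le> y 0 * exp (- g 0)"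
  proof (rule DERIV_nonpos_imp_decreasing_open[OF T])
    fix t :: real assume t: "0 < t" "t < T"
    then obtain D where D: "(y has_real_derivative D) (at t)" "D \<le> g' t * y t"
      using y' by blast
    have "((\<lambda>t. y t * exp (- g t)) has_real_derivative (D - g' t * y t) * exp (- g t)) (at t)"
      by (rule derivative_eq_intros D(1) g refl | simp add: algebra_simps)+
    moreover have "(D - g' t * y t) * exp (- g t) \<le> 0"
      using D(2) by (simp add: mult_nonpos_nonneg)
    ultimately show "\<exists>D. ((\<lambda>t. y t * exp (- g t)) has_real_derivative D) (at t) \<and> D \<le> 0" by blast
  qed (intro continuous_intros y gc)
  then show ?thesis
    by (simp add: exp_diff exp_minus field_simps)
qed

lemma abs_diff_le_of_derivative:
  fixes y g g' :: "real \<Rightarrow> real"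
  assumes T: "0 \<le> T" and y: "continuous_on {0..T} y"
    and g: "\<And>t. (g has_real_derivative g' t) (at t)"
    and y': "\<And>t. 0 < t \<Longrightarrow> t < T \<Longrightarrow> \<exists>D. (y has_real_derivative D) (at t) \<and> \<bar>D\<bar> \<le> g' t"
  shows "\<bar>y T - y 0\<bar> \<le> g T - g 0"
proof -
  have gc: "continuous_on {0..T} g"
    using g by (meson DERIV_isCont continuous_at_imp_continuous_on)
  have "g 0 - y 0 \<le> g T - y T"
  proof (rule DERIV_nonneg_imp_increasing_open[OF T])
    fix t :: real assume t: "0 < t" "t < T"
    then obtain D where D: "(y has_real_derivative D) (at t)" "\<bar>D\<bar> \<le> g' t" using y' by blast
    show "\<exists>z. ((\<lambda>t. g t - y t) has_real_derivative z) (at t) \<and> 0 \<le> z"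
      by (rule exI[of _ "g' t - D"]) (use D g[of t] in \<open>auto intro!: derivative_eq_intros\<close>)
  qed (intro continuous_intros y gc)
  moreover have "g 0 + y 0 \<le> g T + y T"
  proof (rule DERIV_nonneg_imp_increasing_open[OF T])
    fix t :: real assume t: "0 < t" "t < T"
    then obtain D where D: "(y has_real_derivative D) (at t)" "\<bar>D\<bar> \<le> g' t" using y' by blast
    show "\<exists>z. ((\<lambda>t. g t + y t) has_real_derivative z) (at t) \<and> 0 \<le> z"
      by (rule exI[of _ "g' t + D"]) (use D g[of t] in \<open>auto intro!: derivative_eq_intros\<close>)
  qed (intro continuous_intros y gc)
  ultimately show ?thesis by linarith
qed

lemma lin_derivatives:
  "(lin_a a0 w0 has_real_derivative lin_w a0 w0 t) (at t)"
  "(lin_w a0 w0 has_real_derivative lin_a a0 w0 t) (at t)"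
  unfolding lin_a_def[abs_def] lin_w_def[abs_def]
  by (auto intro!: derivative_eq_intros)

locale two_layer_flow = two_layer \<mu> f \<sigma> \<sigma>1 \<sigma>2 \<sigma>3 e1 CL L B
  for \<mu> :: "(real^'d) measure" and f \<sigma> \<sigma>1 \<sigma>2 \<sigma>3 e1 CL L B +
  fixes m :: nat and a :: "real \<Rightarrow> nat \<Rightarrow> real" and w :: "real \<Rightarrow> nat \<Rightarrow> real^'d" and S T :: real
  assumes da0: "\<And>t k. 0 \<le> t \<Longrightarrow> k < m \<Longrightarrow>
      ((\<lambda>\<tau>. a \<tau> k) has_real_derivative - grad_a m (a t) (w t) k) (at t within {0..})"
    and dw0: "\<And>t k i. 0 \<le> t \<Longrightarrow> k < m \<Longrightarrow>
      ((\<lambda>\<tau>. w \<tau> k $ i) has_real_derivative - grad_w m (a t) (w t) k i) (at t within {0..})"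
    and T0: "0 \<le> T" and S0: "0 < S" and init: "total_sq m (a 0) (w 0) \<le> S"
    and small: "3 * (K * (1 + real CARD('d))) * S * exp (2 * T) \<le> 1"
begin

definition K2 :: real where "K2 = K * (1 + real CARD('d))"

lemma K2_ge: "1 \<le> K2"
  unfolding K2_def using K_bounds(1) mult_mono[of 1 K 1 "1 + real CARD('d)"] by simp

lemma da:
  assumes "0 < t" "k < m"
  shows "((\<lambda>\<tau>. a \<tau> k) has_real_derivative - grad_a m (a t) (w t) k) (at t)"
  using da0[of t k] assms by (simp add: at_within_interior[of t "{0..}"])

lemma dw:
  assumes "0 < t" "k < m"
  shows "((\<lambda>\<tau>. w \<tau> k $ i) has_real_derivative - grad_w m (a t) (w t) k i) (at t)"
  using dw0[of t k i] assms by (simp add: at_within_interior[of t "{0..}"])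

lemma continuous_a: "k < m \<Longrightarrow> continuous_on {0..s} (\<lambda>t. a t k)"
  by (rule continuous_on_subset[of "{0..}"])
    (auto simp: continuous_on_eq_continuous_within intro!: DERIV_continuous[OF da0])

lemma continuous_w: "k < m \<Longrightarrow> continuous_on {0..s} (\<lambda>t. w t k $ i)"
  by (rule continuous_on_subset[of "{0..}"])
    (auto simp: continuous_on_eq_continuous_within intro!: DERIV_continuous[OF dw0])

abbreviation nq :: "real \<Rightarrow> nat \<Rightarrow> real" where "nq t k \<equiv> neuron_sq (a t) (w t) k"
abbreviation tq :: "real \<Rightarrow> real" where "tq t \<equiv> total_sq m (a t) (w t)"

lemma neuron_sq_coords: "neuron_sq b v k = (b k)\<^sup>2 + (\<Sum>i\<in>UNIV. (v k $ i)\<^sup>2)"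
  unfolding neuron_sq_def power2_norm_eq_inner inner_vec_def by (simp add: power2_eq_square)

lemma continuous_neuron_sq: "k < m \<Longrightarrow> continuous_on {0..s} (\<lambda>t. nq t k)"
  unfolding neuron_sq_coords by (intro continuous_intros continuous_a continuous_w)

lemma continuous_total_sq: "continuous_on {0..s} tq"
  unfolding total_sq_def by (intro continuous_intros continuous_neuron_sq) auto

lemma neuron_sq_growth:
  assumes t: "0 < t" and k: "k < m" and Q: "tq t \<le> 1"
  shows "\<exists>D. ((\<lambda>t. nq t k) has_real_derivative D) (at t) \<and> D \<le> (2 + K2 * tq t) * nq t k"
proof (intro exI conjI)
  let ?A = "- grad_a m (a t) (w t) k" and ?W = "\<lambda>i. - grad_w m (a t) (w t) k i"
  let ?a = "a t k" and ?w = "\<lambda>i. w t k $ i" and ?n = "norm (w t k)"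
  show "((\<lambda>t. nq t k) has_real_derivative 2 * ?a * ?A + (\<Sum>i\<in>UNIV. 2 * ?w i * ?W i)) (at t)"
    unfolding neuron_sq_coords
    by (rule derivative_eq_intros da[OF t k] dw[OF t k] refl | simp add: mult_ac)+
  have "?a * (?A - ?w e1) \<le> \<bar>?a\<bar> * (K * tq t * ?n)"
    using mult_left_mono[OF grad_a_approx[OF Q k] abs_ge_zero[of ?a]]
      abs_ge_self[of "?a * (?A - ?w e1)"] by (simp add: abs_mult)
  then have 1: "?a * ?A \<le> ?a * ?w e1 + K * tq t * (\<bar>?a\<bar> * ?n)" by (simp add: algebra_simps)
  have "?w i * ?W i \<le> (if i = e1 then ?a * ?w i else 0) + K * tq t * (\<bar>?a\<bar> * ?n)" for i
  proof -
    have "?w i * (?W i - (if i = e1 then ?a else 0)) \<le> \<bar>?w i\<bar> * (K * tq t * \<bar>?a\<bar>)"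
      using mult_left_mono[OF grad_w_approx[OF Q k, of i] abs_ge_zero[of "?w i"]]
        abs_ge_self[of "?w i * (?W i - (if i = e1 then ?a else 0))"] unfolding abs_mult by linarith
    also have "\<dots> \<le> ?n * (K * tq t * \<bar>?a\<bar>)"
      using K_bounds(1) by (intro mult_right_mono component_le_norm_cart) auto
    finally show ?thesis by (auto simp: algebra_simps split: if_splits)
  qed
  then have "(\<Sum>i\<in>UNIV. ?w i * ?W i) \<le> (\<Sum>i\<in>UNIV. (if i = e1 then ?a * ?w i else 0) + K * tq t * (\<bar>?a\<bar> * ?n))"
    by (intro sum_mono) auto
  also have "\<dots> = ?a * ?w e1 + real CARD('d) * (K * tq t * (\<bar>?a\<bar> * ?n))"
    by (simp add: sum.distrib)
  finally have 2: "(\<Sum>i\<in>UNIV. ?w i * ?W i) \<le> ?a * ?w e1 + real CARD('d) * (K * tq t * (\<bar>?a\<bar> * ?n))" .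
  have aw: "\<bar>?a * ?w e1\<bar> \<le> \<bar>?a\<bar> * ?n"
    unfolding abs_mult by (intro mult_left_mono component_le_norm_cart) auto
  have "2 * ?a * ?A + (\<Sum>i\<in>UNIV. 2 * ?w i * ?W i) = 2 * (?a * ?A) + 2 * (\<Sum>i\<in>UNIV. ?w i * ?W i)"
    by (simp add: sum_distrib_left mult_ac)
  also have "\<dots> \<le> 4 * (\<bar>?a\<bar> * ?n) + K2 * tq t * (2 * (\<bar>?a\<bar> * ?n))"
    using 1 2 aw unfolding K2_def by (simp add: algebra_simps)
  also have "\<dots> \<le> 2 * nq t k + K2 * tq t * nq t k"
    using mult_le_neuron_sq[of "a t" k "w t"] K2_ge by (intro add_mono mult_left_mono) auto
  finally show "2 * ?a * ?A + (\<Sum>i\<in>UNIV. 2 * ?w i * ?W i) \<le> (2 + K2 * tq t) * nq t k"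
    by (simp add: algebra_simps)
qed

lemma small_exp: "t \<le> T \<Longrightarrow> 3 * K2 * S * exp (2 * t) \<le> 1"
  using small mult_left_mono[of "exp (2 * t)" "exp (2 * T)" "3 * K2 * S"] K2_ge S0
  by (simp add: K2_def)

lemma S_exp_le_1: "t \<le> T \<Longrightarrow> 3 * S * exp (2 * t) \<le> 1"
  by (rule order_trans[OF _ small_exp[of t]]) (use K2_ge S0 in simp_all)

lemma neuron_sq_bound_aux:
  assumes s: "0 \<le> s" "s \<le> T" and k: "k < m"
    and Q: "\<And>t. 0 < t \<Longrightarrow> t < s \<Longrightarrow> tq t \<le> 3 * S * exp (2 * t)"
  shows "nq s k \<le> 2 * nq 0 k * exp (2 * s)"
proof -
  define g where "g t = 2 * t + 3/2 * K2 * S * exp (2 * t)" for t :: real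
  have main: "nq s k \<le> nq 0 k * exp (g s - g 0)"
  proof (rule gronwall_exp[OF s(1) continuous_neuron_sq[OF k], of g "\<lambda>t. 2 + 3 * K2 * S * exp (2 * t)"])
    show "(g has_real_derivative 2 + 3 * K2 * S * exp (2 * t)) (at t)" for t
      unfolding g_def[abs_def] by (auto intro!: derivative_eq_intros)
    fix t :: real assume t: "0 < t" "t < s"
    have "tq t \<le> 1" using Q[OF t] S_exp_le_1[of t] t s by linarith
    then obtain D where D: "((\<lambda>t. nq t k) has_real_derivative D) (at t)" "D \<le> (2 + K2 * tq t) * nq t k"
      using neuron_sq_growth[OF t(1) k] by blast
    have "(2 + K2 * tq t) * nq t k \<le> (2 + K2 * (3 * S * exp (2 * t))) * nq t k"
      using Q[OF t] K2_ge by (intro mult_right_mono add_left_mono mult_left_mono) auto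
    then show "\<exists>D. ((\<lambda>t. nq t k) has_real_derivative D) (at t) \<and> D \<le> (2 + 3 * K2 * S * exp (2 * t)) * nq t k"
      using D by (intro exI[of _ D]) (simp add: mult_ac)
  qed
  have "exp (g s - g 0) \<le> exp (2 * s + 1/2)"
  proof -
    have "0 \<le> 3 * K2 * S" using K2_ge S0 by simp
    then have "g s - g 0 \<le> 2 * s + 1/2"
      using small_exp[OF s(2)] unfolding g_def by (simp add: algebra_simps del: zero_le_mult_iff)
    then show ?thesis by simp
  qed
  also have "exp (2 * s + 1/2) \<le> 2 * exp (2 * s)"
  proof -
    have "(exp (1/2 :: real))\<^sup>2 \<le> 2\<^sup>2" using exp_le by (simp add: exp_double[symmetric])
    then have "exp (1/2 :: real) \<le> 2" by (rule power2_le_imp_le) simp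
    then show ?thesis by (simp add: exp_add)
  qed
  finally have "nq 0 k * exp (g s - g 0) \<le> nq 0 k * (2 * exp (2 * s))"
    by (rule mult_left_mono) simp
  then show ?thesis using main by (simp add: mult_ac)
qed

lemma total_sq_bound_aux:
  assumes s: "0 \<le> s" "s \<le> T"
    and Q: "\<And>t. 0 < t \<Longrightarrow> t < s \<Longrightarrow> tq t \<le> 3 * S * exp (2 * t)"
  shows "tq s < 3 * S * exp (2 * s)"
proof -
  have "tq s \<le> (\<Sum>k<m. 2 * nq 0 k * exp (2 * s))"
    unfolding total_sq_def using neuron_sq_bound_aux[OF s _ Q] by (intro sum_mono) auto
  also have "\<dots> = 2 * exp (2 * s) * tq 0"
    by (simp add: total_sq_def sum_distrib_left mult_ac)
  also have "\<dots> \<le> 2 * exp (2 * s) * S" using init by (intro mult_left_mono) auto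
  also have "\<dots> < 3 * S * exp (2 * s)" using S0 by simp
  finally show ?thesis .
qed

lemma total_sq_bound:
  assumes t: "0 \<le> t" "t \<le> T"
  shows "tq t \<le> 3 * S * exp (2 * t)"
proof (rule ccontr)
  assume neg: "\<not> tq t \<le> 3 * S * exp (2 * t)"
  define h where "h t = tq t - 3 * S * exp (2 * t)" for t
  have h: "continuous_on {0..T} h"
    unfolding h_def[abs_def] by (intro continuous_intros continuous_total_sq)
  define A where "A = {0..T} \<inter> h -` {0..}"
  have "closed A"
    unfolding A_def by (intro continuous_closed_preimage h) auto
  then have "compact A"
    unfolding A_def by (metis bounded_closed_interval bounded_Int compact_eq_bounded_closed)
  moreover have "A \<noteq> {}" using neg t by (auto simp: A_def h_def intro!: exI[of _ t])
  ultimately obtain s where s: "s \<in> A" "\<And>r. r \<in> A \<Longrightarrow> s \<le> r"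
    by (meson compact_attains_inf)
  have "tq s < 3 * S * exp (2 * s)"
  proof (rule total_sq_bound_aux)
    fix r assume "0 < r" "r < s"
    then have "r \<notin> A" using s(2)[of r] by auto
    then show "tq r \<le> 3 * S * exp (2 * r)"
      using \<open>0 < r\<close> \<open>r < s\<close> s(1) by (auto simp: A_def h_def)
  qed (use s in \<open>auto simp: A_def\<close>)
  then show False using s(1) by (auto simp: A_def h_def)
qed

lemma neuron_sq_bound: "0 \<le> t \<Longrightarrow> t \<le> T \<Longrightarrow> k < m \<Longrightarrow> nq t k \<le> 2 * nq 0 k * exp (2 * t)"
  using neuron_sq_bound_aux[of t k] total_sq_bound by auto

lemma total_sq_le_1: "0 \<le> t \<Longrightarrow> t \<le> T \<Longrightarrow> tq t \<le> 1"
  using total_sq_bound[of t] S_exp_le_1[of t] by linarith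

lemma prisk_change: "\<bar>prisk m (a T) (w T) - prisk m (a 0) (w 0)\<bar> \<le> 4 * K * S * exp (2 * T)"
proof -
  have "S * 1 \<le> S * exp (2 * T)" using S0 T0 by (intro mult_left_mono) auto
  then have "tq T + tq 0 \<le> 4 * S * exp (2 * T)"
    using total_sq_bound[OF T0 order_refl] init by simp
  then have "K * (tq T + tq 0) \<le> K * (4 * S * exp (2 * T))"
    using K_bounds(1) by (intro mult_left_mono) auto
  then show ?thesis
    using prisk_near_zero[OF total_sq_le_1[OF T0 order_refl]] prisk_near_zero[OF total_sq_le_1[OF order_refl T0]]
    by (simp add: algebra_simps)
qed

context
  fixes n :: real
  assumes n0: "0 \<le> n" and n: "\<And>k. k < m \<Longrightarrow> nq 0 k \<le> n\<^sup>2"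
begin

lemma param_bound:
  assumes t: "0 \<le> t" "t \<le> T" and k: "k < m"
  shows "\<bar>a t k\<bar> \<le> 2 * n * exp t" "norm (w t k) \<le> 2 * n * exp t"
proof -
  have "nq t k \<le> 2 * n\<^sup>2 * exp (2 * t)"
    by (rule order_trans[OF neuron_sq_bound[OF t k]]) (use n[OF k] in simp)
  also have "\<dots> \<le> 4 * n\<^sup>2 * exp (2 * t)" by (intro mult_right_mono) auto
  also have "\<dots> = (2 * n * exp t)\<^sup>2" by (simp add: power_mult_distrib exp_double)
  finally have "nq t k \<le> (2 * n * exp t)\<^sup>2" .
  then have "\<bar>a t k\<bar>\<^sup>2 \<le> (2 * n * exp t)\<^sup>2" "(norm (w t k))\<^sup>2 \<le> (2 * n * exp t)\<^sup>2"
    unfolding neuron_sq_def using zero_le_power2[of "a t k"] zero_le_power2[of "norm (w t k)"]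
    by (simp_all only: power2_abs)
  then show "\<bar>a t k\<bar> \<le> 2 * n * exp t" "norm (w t k) \<le> 2 * n * exp t"
    using n0 by (auto intro: power2_le_imp_le)
qed

lemma linear_error:
  assumes t: "0 < t" "t \<le> T" and k: "k < m"
  shows "\<bar>- grad_a m (a t) (w t) k - w t k $ e1\<bar> \<le> 6 * K * S * n * exp (3 * t)"
    and "\<bar>- grad_w m (a t) (w t) k e1 - a t k\<bar> \<le> 6 * K * S * n * exp (3 * t)"
proof -
  have tt: "0 \<le> t" "t \<le> T" using t by auto
  have *: "K * tq t * r \<le> 6 * K * S * n * exp (3 * t)" if "0 \<le> r" "r \<le> 2 * n * exp t" for r
  proof -
    have "K * tq t * r \<le> K * (3 * S * exp (2 * t)) * (2 * n * exp t)"
      using that total_sq_bound[OF tt] K_bounds(1) S0 by (intro mult_mono) auto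
    also have "\<dots> = 6 * K * S * n * (exp (2 * t) * exp t)" by simp
    also have "exp (2 * t) * exp t = exp (3 * t)" by (simp add: exp_add[symmetric])
    finally show ?thesis .
  qed
  show "\<bar>- grad_a m (a t) (w t) k - w t k $ e1\<bar> \<le> 6 * K * S * n * exp (3 * t)"
    using grad_a_approx[OF total_sq_le_1[OF tt] k] *[OF norm_ge_zero param_bound(2)[OF tt k]] by linarith
  show "\<bar>- grad_w m (a t) (w t) k e1 - a t k\<bar> \<le> 6 * K * S * n * exp (3 * t)"
    using grad_w_approx[OF total_sq_le_1[OF tt] k, of e1] *[OF abs_ge_zero param_bound(1)[OF tt k]] by simp
qed

lemma remainder_bound:
  assumes t: "0 \<le> t" "t \<le> T" and k: "k < m"
  shows "\<bar>a t k - lin_a (a 0 k) (w 0 k $ e1) t\<bar> + \<bar>w t k $ e1 - lin_w (a 0 k) (w 0 k $ e1) t\<bar>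
       \<le> 6 * K * S * n * exp (3 * t)"
proof -
  define c where "c = 6 * K * S * n"
  have c0: "0 \<le> c" using K_bounds(1) S0 n0 by (simp add: c_def)
  define u where "u s = a s k - lin_a (a 0 k) (w 0 k $ e1) s" for s
  define v where "v s = w s k $ e1 - lin_w (a 0 k) (w 0 k $ e1) s" for s
  have lc: "continuous_on {0..t} (lin_a x y)" "continuous_on {0..t} (lin_w x y)" for x y
    using lin_derivatives by (meson DERIV_isCont continuous_at_imp_continuous_on)+
  have uc: "continuous_on {0..t} u" "continuous_on {0..t} v"
    unfolding u_def[abs_def] v_def[abs_def] by (intro continuous_intros continuous_a[OF k] continuous_w[OF k] lc)+
  have uv0: "u 0 = 0" "v 0 = 0" by (simp_all add: u_def v_def lin_a_def lin_w_def field_simps)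
  have duv: "\<exists>E E'. (u has_real_derivative v s + E) (at s) \<and> (v has_real_derivative u s + E') (at s)
      \<and> \<bar>E\<bar> \<le> c * exp (3 * s) \<and> \<bar>E'\<bar> \<le> c * exp (3 * s)" if s: "0 < s" "s < t" for s
  proof (intro exI conjI)
    show "\<bar>- grad_a m (a s) (w s) k - w s k $ e1\<bar> \<le> c * exp (3 * s)"
      "\<bar>- grad_w m (a s) (w s) k e1 - a s k\<bar> \<le> c * exp (3 * s)"
      using linear_error[of s k] s t k by (auto simp: c_def)
    show "(u has_real_derivative v s + (- grad_a m (a s) (w s) k - w s k $ e1)) (at s)"
      unfolding u_def[abs_def] v_def
      by (rule derivative_eq_intros da[OF s(1) k] lin_derivatives refl | simp)+
    show "(v has_real_derivative u s + (- grad_w m (a s) (w s) k e1 - a s k)) (at s)"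
      unfolding v_def[abs_def] u_def
      by (rule derivative_eq_intros dw[OF s(1) k] lin_derivatives refl | simp)+
  qed
  have "\<bar>(u t + v t) * exp (- t) - (u 0 + v 0) * exp (- 0)\<bar> \<le> c * exp (2 * t) - c * exp (2 * 0)"
  proof (rule abs_diff_le_of_derivative[OF t(1), where g' = "\<lambda>s. 2 * c * exp (2 * s)"])
    fix s :: real assume s: "0 < s" "s < t"
    obtain E E' where E: "(u has_real_derivative v s + E) (at s)" "(v has_real_derivative u s + E') (at s)"
      "\<bar>E\<bar> \<le> c * exp (3 * s)" "\<bar>E'\<bar> \<le> c * exp (3 * s)" using duv[OF s] by blast
    have "((\<lambda>s. (u s + v s) * exp (- s)) has_real_derivative (E + E') * exp (- s)) (at s)"
      by (rule derivative_eq_intros E refl | simp add: algebra_simps)+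
    moreover have "\<bar>(E + E') * exp (- s)\<bar> \<le> (2 * c * exp (3 * s)) * exp (- s)"
      unfolding abs_mult abs_exp_cancel using E(3,4) by (intro mult_right_mono) auto
    moreover have "exp (3 * s) * exp (- s) = exp (2 * s)" by (simp add: exp_add[symmetric])
    ultimately show "\<exists>D. ((\<lambda>s. (u s + v s) * exp (- s)) has_real_derivative D) (at s) \<and> \<bar>D\<bar> \<le> 2 * c * exp (2 * s)"
      by (auto simp: mult.assoc)
  qed (auto intro!: derivative_eq_intros continuous_intros uc)
  then have "\<bar>u t + v t\<bar> * exp (- t) \<le> c * exp (2 * t)"
    using uv0 c0 by (simp add: abs_mult)
  then have "\<bar>u t + v t\<bar> * exp (- t) * exp t \<le> c * exp (2 * t) * exp t"
    by (rule mult_right_mono) simp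
  then have p: "\<bar>u t + v t\<bar> \<le> c * exp (3 * t)"
    by (simp add: mult.assoc mult_exp_exp)
  have "\<bar>(u t - v t) * exp t - (u 0 - v 0) * exp 0\<bar> \<le> c * exp (4 * t) - c * exp (4 * 0)"
  proof (rule abs_diff_le_of_derivative[OF t(1), where g' = "\<lambda>s. 4 * c * exp (4 * s)"])
    fix s :: real assume s: "0 < s" "s < t"
    obtain E E' where E: "(u has_real_derivative v s + E) (at s)" "(v has_real_derivative u s + E') (at s)"
      "\<bar>E\<bar> \<le> c * exp (3 * s)" "\<bar>E'\<bar> \<le> c * exp (3 * s)" using duv[OF s] by blast
    have "((\<lambda>s. (u s - v s) * exp s) has_real_derivative (E - E') * exp s) (at s)"
      by (rule derivative_eq_intros E refl | simp add: algebra_simps)+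
    moreover have "\<bar>(E - E') * exp s\<bar> \<le> (4 * c * exp (3 * s)) * exp s"
      unfolding abs_mult abs_exp_cancel using E(3,4) c0 by (intro mult_right_mono) auto
    moreover have "exp (3 * s) * exp s = exp (4 * s)" by (simp add: exp_add[symmetric])
    ultimately show "\<exists>D. ((\<lambda>s. (u s - v s) * exp s) has_real_derivative D) (at s) \<and> \<bar>D\<bar> \<le> 4 * c * exp (4 * s)"
      by (auto simp: mult.assoc)
  qed (auto intro!: derivative_eq_intros continuous_intros uc)
  then have "\<bar>u t - v t\<bar> * exp t \<le> c * exp (4 * t)"
    using uv0 c0 by (simp add: abs_mult)
  then have "\<bar>u t - v t\<bar> * exp t * exp (- t) \<le> c * exp (4 * t) * exp (- t)"
    by (rule mult_right_mono) simp
  then have q: "\<bar>u t - v t\<bar> \<le> c * exp (3 * t)"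
    by (simp add: mult.assoc mult_exp_exp)
  have "\<bar>u t\<bar> + \<bar>v t\<bar> \<le> c * exp (3 * t)"
    using p q by linarith
  then show ?thesis by (simp add: u_def v_def c_def)
qed

lemma orthogonal_bound:
  assumes i: "i \<noteq> e1" and k: "k < m" and small2: "4 * real m * n\<^sup>2 * exp (2 * T) \<le> 1"
  shows "\<bar>w T k $ i\<bar> \<le> 2 * n + 6 * K * n ^ 3 * exp (3 * T)"
proof -
  define V where "V = (\<Union>k\<in>{..<m}. (\<lambda>t. \<bar>w t k $ i\<bar>) ` {0..T})"
  define P where "P = Sup V"
  have "compact V"
    unfolding V_def
    by (intro compact_UN finite_lessThan compact_continuous_image continuous_intros continuous_w) auto
  then have bdd: "bdd_above V"
    by (intro bounded_imp_bdd_above compact_imp_bounded)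
  have P: "\<bar>w t l $ i\<bar> \<le> P" if "0 \<le> t" "t \<le> T" "l < m" for t l
    unfolding P_def using that by (intro cSup_upper bdd) (force simp: V_def)
  have P0: "0 \<le> P" using P[OF order_refl T0 k] abs_ge_zero[of "w 0 k $ i"] by linarith
  define g where "g t = 2 * real m * n\<^sup>2 * P * exp (2 * t) + 8/3 * K * n ^ 3 * exp (3 * t)" for t :: real
  have gmono: "g t \<le> g T" if "t \<le> T" for t
    unfolding g_def using that P0 n0 K_bounds(1) by (intro add_mono mult_left_mono) auto
  have step: "\<bar>w t l $ i\<bar> \<le> n + g T" if t: "0 \<le> t" "t \<le> T" and l: "l < m" for t l
  proof -
    have "\<bar>w t l $ i - w 0 l $ i\<bar> \<le> g t - g 0"
    proof (rule abs_diff_le_of_derivative[OF t(1) continuous_w[OF l], where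
          g' = "\<lambda>t. 4 * real m * n\<^sup>2 * P * exp (2 * t) + 8 * K * n ^ 3 * exp (3 * t)"])
      show "(g has_real_derivative 4 * real m * n\<^sup>2 * P * exp (2 * s) + 8 * K * n ^ 3 * exp (3 * s)) (at s)" for s
        unfolding g_def[abs_def] by (auto intro!: derivative_eq_intros)
      fix s assume "0 < s" "s < t"
      then have s: "0 < s" "0 \<le> s" "s \<le> T" using t by auto
      let ?N = "2 * n * exp s"
      have N0: "0 \<le> ?N" using n0 by simp
      have "\<bar>\<Sum>j<m. a s j * w s j $ i\<bar> \<le> (\<Sum>j<m. \<bar>a s j * w s j $ i\<bar>)" by (rule sum_abs)
      also have "\<dots> \<le> (\<Sum>j<m. ?N * P)"
        unfolding abs_mult using param_bound(1)[OF s(2,3)] P[OF s(2,3)] N0 by (intro sum_mono mult_mono) auto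
      finally have Z: "\<bar>\<Sum>j<m. a s j * w s j $ i\<bar> \<le> real m * (?N * P)" by simp
      have "\<bar>grad_w m (a s) (w s) l i\<bar> \<le> \<bar>a s l\<bar> * (\<bar>\<Sum>j<m. a s j * w s j $ i\<bar> + K * ?N\<^sup>2)"
        by (rule grad_w_orthogonal[OF total_sq_le_1[OF s(2,3)] l i]) (rule param_bound(2)[OF s(2,3)])
      also have "\<dots> \<le> ?N * (real m * (?N * P) + K * ?N\<^sup>2)"
        using param_bound(1)[OF s(2,3) l] Z N0 K_bounds(1) by (intro mult_mono add_mono) auto
      also have "\<dots> = 4 * real m * n\<^sup>2 * P * (exp s * exp s) + 8 * K * n ^ 3 * (exp s * exp s * exp s)"
        by (simp add: power2_eq_square power3_eq_cube algebra_simps)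
      also have "\<dots> = 4 * real m * n\<^sup>2 * P * exp (2 * s) + 8 * K * n ^ 3 * exp (3 * s)"
        by (simp add: exp_add[symmetric])
      finally show "\<exists>D. ((\<lambda>t. w t l $ i) has_real_derivative D) (at s) \<and>
          \<bar>D\<bar> \<le> 4 * real m * n\<^sup>2 * P * exp (2 * s) + 8 * K * n ^ 3 * exp (3 * s)"
        using dw[OF s(1) l, of i] by (intro exI[of _ "- grad_w m (a s) (w s) l i"]) auto
    qed
    moreover have "\<bar>w 0 l $ i\<bar> \<le> n"
    proof -
      have "(norm (w 0 l))\<^sup>2 \<le> n\<^sup>2"
        using n[OF l] zero_le_power2[of "a 0 l"] unfolding neuron_sq_def by linarith
      then have "norm (w 0 l) \<le> n" using n0 by (rule power2_le_imp_le)
      then show ?thesis using component_le_norm_cart[of "w 0 l" i] by linarith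
    qed
    moreover have "0 \<le> g 0" unfolding g_def using P0 n0 K_bounds(1) by simp
    ultimately show ?thesis using gmono[OF t(2)] by linarith
  qed
  have "P \<le> n + g T"
    unfolding P_def using step k T0 by (intro cSup_least) (auto simp: V_def)
  moreover have "2 * real m * n\<^sup>2 * P * exp (2 * T) \<le> P / 2"
    using mult_right_mono[OF small2 P0] by (simp add: mult_ac)
  moreover have "8/3 * K * n ^ 3 * exp (3 * T) \<le> 3 * K * n ^ 3 * exp (3 * T)"
    using K_bounds(1) n0 by (intro mult_right_mono) auto
  ultimately have "P \<le> 2 * n + 6 * K * n ^ 3 * exp (3 * T)"
    unfolding g_def by linarith
  then show ?thesis using P[OF T0 order_refl k] by linarith
qed

end
end

section \<open>Conclusion\<close>

lemma two_layer_density: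
  fixes \<rho> f :: "real^'d \<Rightarrow> real"
  assumes rho_meas: "\<rho> \<in> borel_measurable lborel"
    and rho_nonneg: "\<And>x. \<rho> x \<ge> 0"
    and rho_prob: "integrable lborel \<rho>" "(LINT x|lborel. \<rho> x) = 1"
    and rho_cpt: "compact (closure {x. \<rho> x \<noteq> 0})"
    and rho_mom: "\<And>i j. (LINT x|lborel. x $ i * x $ j * \<rho> x) = (if i = j then 1 else 0)"
    and f_meas: "f \<in> borel_measurable lborel"
    and f_bdd: "\<exists>B. \<forall>x\<in>closure {x. \<rho> x \<noteq> 0}. \<bar>f x\<bar> \<le> B"
    and f_corr: "\<And>i. (LINT x|lborel. f x * x $ i * \<rho> x) = (if i = e1 then 1 else 0)"
    and s1: "\<And>z. (\<sigma> has_real_derivative \<sigma>1 z) (at z)"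
    and s2: "\<And>z. (\<sigma>1 has_real_derivative \<sigma>2 z) (at z)"
    and s3: "\<And>z. (\<sigma>2 has_real_derivative \<sigma>3 z) (at z)"
    and s0: "\<sigma> 0 = 0" "\<sigma>1 0 = 1" "\<sigma>2 0 = 0"
    and sL: "\<And>z. \<bar>\<sigma>3 z\<bar> \<le> CL"
  shows "\<exists>L B. two_layer (density lborel (\<lambda>x. ennreal (\<rho> x))) f \<sigma> \<sigma>1 \<sigma>2 \<sigma>3 e1 CL L B"
proof -
  define \<mu> where "\<mu> = density lborel (\<lambda>x. ennreal (\<rho> x))"
  note [measurable] = rho_meas f_meas
  obtain L where L: "\<And>x. x \<in> closure {x. \<rho> x \<noteq> 0} \<Longrightarrow> norm x \<le> L"
    using compact_imp_bounded[OF rho_cpt] unfolding bounded_iff by blast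
  obtain B where B: "\<And>x. x \<in> closure {x. \<rho> x \<noteq> 0} \<Longrightarrow> \<bar>f x\<bar> \<le> B"
    using f_bdd by blast
  have "(\<integral>\<^sup>+x. ennreal (\<rho> x) \<partial>lborel) = 1"
    using rho_prob rho_nonneg by (simp add: nn_integral_eq_integral)
  then have prob: "prob_space \<mu>"
    unfolding \<mu>_def by (intro prob_spaceI) (simp add: emeasure_density)
  have int: "(\<integral>x. g x \<partial>\<mu>) = (LINT x|lborel. g x * \<rho> x)" if [measurable]: "g \<in> borel_measurable lborel" for g :: "real^'d \<Rightarrow> real"
    unfolding \<mu>_def using rho_nonneg by (subst integral_density) (auto simp: mult.commute)
  have "two_layer \<mu> f \<sigma> \<sigma>1 \<sigma>2 \<sigma>3 e1 CL (max 1 L) (max 1 B)"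
    unfolding two_layer_def two_layer_axioms_def
  proof (intro conjI allI prob s1 s2 s3 s0 sL)
    show "AE x in \<mu>. norm x \<le> max 1 L \<and> \<bar>f x\<bar> \<le> max 1 B"
    proof -
      have "norm x \<le> max 1 L \<and> \<bar>f x\<bar> \<le> max 1 B" if "0 < ennreal (\<rho> x)" for x
      proof -
        have "x \<in> closure {x. \<rho> x \<noteq> 0}"
          using that closure_subset[of "{x. \<rho> x \<noteq> 0}"] by auto
        then show ?thesis using L B by (auto simp: le_max_iff_disj)
      qed
      then show ?thesis unfolding \<mu>_def by (subst AE_density) auto
    qed
    show "sets \<mu> = sets borel" by (simp add: \<mu>_def)
  qed (use f_meas in \<open>auto simp: int rho_mom f_corr\<close>)
  then show ?thesis unfolding \<mu>_def by blast
qed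

lemma Tp_eq: "Tp \<alpha> m = (\<alpha> - alpha1 \<alpha>) * ln (real m)"
  by (simp add: Tp_def alpha1_def field_simps)

lemma gamma1_eq: "gamma1 \<alpha> = 3 * alpha1 \<alpha> - 1"
  by (simp add: gamma1_def alpha1_def)

lemma alpha1_bounds:
  assumes "\<alpha> > 1/2"
  shows "1/2 < alpha1 \<alpha>" "alpha1 \<alpha> < \<alpha>"
  using assms by (auto simp: alpha1_def)

lemma qmax_less_iff:
  assumes "0 < m"
  shows "qmax m a w t < c \<longleftrightarrow> (\<forall>k<m. \<bar>a t k\<bar> < c \<and> (\<forall>i. \<bar>w t k $ i\<bar> < c))"
proof -
  have 1: "{\<bar>a t k\<bar> | k. k < m} = (\<lambda>k. \<bar>a t k\<bar>) ` {..<m}" by auto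
  have 2: "{\<bar>w t k $ i\<bar> | k i. k < m} = (\<lambda>(k, i). \<bar>w t k $ i\<bar>) ` ({..<m} \<times> UNIV)" by auto
  have "finite ({\<bar>a t k\<bar> | k. k < m} \<union> {\<bar>w t k $ i\<bar> | k i. k < m})"
    unfolding 1 2 by auto
  then show ?thesis
    unfolding qmax_def using assms by (subst Max_less_iff) auto
qed

lemma rmax_less_iff:
  assumes "0 < m"
  shows "rmax m e1 a w t < c \<longleftrightarrow> (\<forall>k<m. \<bar>a t k - lin_a (a 0 k) (w 0 k $ e1) t\<bar>
                         + \<bar>w t k $ e1 - lin_w (a 0 k) (w 0 k $ e1) t\<bar> < c)"
proof -
  have "finite {\<bar>a t k - lin_a (a 0 k) (w 0 k $ e1) t\<bar>
      + \<bar>w t k $ e1 - lin_w (a 0 k) (w 0 k $ e1) t\<bar> | k. k < m}"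
    by (rule finite_image_set) simp
  then show ?thesis
    unfolding rmax_def using assms by (subst Max_less_iff) auto
qed

lemma eventually_large_width:
  fixes \<alpha> A A' A'' \<delta> c :: real
  assumes c: "c > 0" and \<alpha>: "\<alpha> > 0" and \<delta>: "\<delta> > 0"
  shows "eventually (\<lambda>m::nat. m > 0 \<and> ln (real m) \<ge> 1 \<and> A * real m powr (- c) \<le> 1
     \<and> (ln (real m))\<^sup>2 * real m powr (- c) \<le> 1 \<and> A' * ln (real m) < (ln (real m)) ^ 3
     \<and> (ln (real m))\<^sup>2 * real m powr (- \<alpha>) \<le> 1 \<and> A'' * real m powr (- 1) \<le> \<delta>) sequentially"
proof -
  have lim1: "((\<lambda>m. real m powr (- p)) \<longlonglongrightarrow> 0)" if "p > 0" for p :: real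
    using that by real_asymp
  have lim2: "((\<lambda>m. (ln (real m))\<^sup>2 * real m powr (- p)) \<longlonglongrightarrow> 0)" if "p > 0" for p :: real
    using that by real_asymp
  have 1: "eventually (\<lambda>m. A * real m powr (- c) < 1) sequentially"
    by (rule order_tendstoD(2)[OF tendsto_mult_right_zero[OF lim1[OF c]]]) simp
  have 2: "eventually (\<lambda>m. A'' * real m powr (- 1) < \<delta>) sequentially"
    by (rule order_tendstoD(2)[OF tendsto_mult_right_zero[OF lim1[of 1]]]) (use \<delta> in simp_all)
  have 3: "eventually (\<lambda>m. (ln (real m))\<^sup>2 * real m powr (- c) < 1) sequentially"
    by (rule order_tendstoD(2)[OF lim2[OF c]]) simp
  have 4: "eventually (\<lambda>m. (ln (real m))\<^sup>2 * real m powr (- \<alpha>) < 1) sequentially"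
    by (rule order_tendstoD(2)[OF lim2[OF \<alpha>]]) simp
  have "filterlim (\<lambda>m. (ln (real m))\<^sup>2) at_top sequentially" by real_asymp
  then have 5: "eventually (\<lambda>m. (ln (real m))\<^sup>2 > A') sequentially"
    by (simp add: filterlim_at_top_dense)
  have 6: "eventually (\<lambda>m. ln (real m) \<ge> 1) sequentially" by real_asymp
  have 7: "eventually (\<lambda>m::nat. m > 0) sequentially" by (rule eventually_gt_at_top)
  from 1 2 3 4 5 6 7 show ?thesis
  proof eventually_elim
    case (elim m)
    have "A' * ln (real m) < (ln (real m))\<^sup>2 * ln (real m)"
      by (rule mult_strict_right_mono) (use elim in linarith)+
    then show ?case using elim by (simp add: power2_eq_square power3_eq_cube)
  qed
qed


theorem theorem1:
  fixes \<rho> f :: "real^'d \<Rightarrow> real"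
    and \<sigma> \<sigma>1 \<sigma>2 \<sigma>3 :: "real \<Rightarrow> real"
    and e1 :: 'd
    and CL \<alpha> :: real
  assumes dim: "CARD('d) \<ge> 2"
    and rho_meas: "\<rho> \<in> borel_measurable lborel"
    and rho_nonneg: "\<And>x. \<rho> x \<ge> 0"
    and rho_prob: "integrable lborel \<rho>" "(LINT x|lborel. \<rho> x) = 1"
    and rho_cpt: "compact (closure {x. \<rho> x \<noteq> 0})"
    and rho_mom: "\<And>i j. (LINT x|lborel. x $ i * x $ j * \<rho> x) = (if i = j then 1 else 0)"
    and f_meas: "f \<in> borel_measurable lborel"
    and f_bdd: "\<exists>B. \<forall>x\<in>closure {x. \<rho> x \<noteq> 0}. \<bar>f x\<bar> \<le> B"
    and f_corr: "\<And>i. (LINT x|lborel. f x * x $ i * \<rho> x) = (if i = e1 then 1 else 0)"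
    and s1: "\<And>z. (\<sigma> has_real_derivative \<sigma>1 z) (at z)"
    and s2: "\<And>z. (\<sigma>1 has_real_derivative \<sigma>2 z) (at z)"
    and s3: "\<And>z. (\<sigma>2 has_real_derivative \<sigma>3 z) (at z)"
    and s0: "\<sigma> 0 = 0" "\<sigma>1 0 = 1" "\<sigma>2 0 = 0"
    and sL: "\<And>z. \<bar>\<sigma>3 z\<bar> \<le> CL"
    and alpha: "\<alpha> > 1/2"
  shows "\<forall>\<delta>. 0 < \<delta> \<and> \<delta> < 1 \<longrightarrow>
    (\<exists>M::nat. \<exists>C>0. \<forall>m::nat. m \<ge> M \<and> m \<ge> 2 \<longrightarrow>
      (\<exists>E\<in>sets (init_measure m \<alpha> :: (nat \<Rightarrow> real \<times> (real^'d)) measure).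
         measure (init_measure m \<alpha>) E \<ge> 1 - \<delta> \<and>
         (\<forall>\<theta>0\<in>E. \<forall>a w. grad_flow m \<sigma> f \<rho> \<theta>0 a w \<longrightarrow>
            ereal (Tp \<alpha> m) \<le> T1 \<alpha> m e1 a w \<and>
            (\<forall>k<m. \<forall>i. i \<noteq> e1 \<longrightarrow>
               \<bar>w (Tp \<alpha> m) k $ i\<bar> \<le> C * max (ln (real m) / real m powr \<alpha>) ((ln (real m)) ^ 6 / real m ^ 3)) \<and>
            \<bar>risk m \<sigma> f \<rho> (a (Tp \<alpha> m)) (w (Tp \<alpha> m)) - risk m \<sigma> f \<rho> (a 0) (w 0)\<bar> / Tp \<alpha> m
              \<le> C / (real m powr (2 * alpha1 \<alpha> - 1) * ln (real m)))))"
proof (intro allI impI)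
  fix \<delta> :: real assume \<delta>: "0 < \<delta> \<and> \<delta> < 1"
  define \<mu> where "\<mu> = density lborel (\<lambda>x. ennreal (\<rho> x))"
  obtain L B where "two_layer \<mu> f \<sigma> \<sigma>1 \<sigma>2 \<sigma>3 e1 CL L B"
    using two_layer_density[OF rho_meas rho_nonneg rho_prob rho_cpt rho_mom f_meas f_bdd f_corr s1 s2 s3 s0 sL]
    unfolding \<mu>_def by blast
  then interpret TL: two_layer \<mu> f \<sigma> \<sigma>1 \<sigma>2 \<sigma>3 e1 CL L B .
  have risk_eq: "risk m \<sigma> f \<rho> a w = TL.prisk m a w" for m a w
    unfolding risk_def TL.prisk_def unfolding \<mu>_def
    using rho_nonneg rho_meas by (subst integral_density) (auto simp: mult.commute)
  let ?K = TL.K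
  define \<beta> where "\<beta> = alpha1 \<alpha>"
  have \<beta>: "1/2 < \<beta>" "\<beta> < \<alpha>" unfolding \<beta>_def using alpha1_bounds[OF alpha] by auto
  define D where "D = real DIM(real \<times> (real^'d))"
  have D0: "D > 0" by (simp add: D_def)
  define Bc where "Bc = 2 * D / \<delta>"
  have Bc0: "Bc > 0" using D0 \<delta> by (simp add: Bc_def)
  define l where "l = 8 * D"
  define c where "c = 2 * \<beta> - 1"
  have K1: "1 \<le> ?K" by (rule TL.K_bounds(1))
  have "eventually (\<lambda>m::nat. m > 0 \<and> ln (real m) \<ge> 1
     \<and> (3 * (?K * (1 + real CARD('d))) * Bc) * real m powr (- c) \<le> 1
     \<and> (ln (real m))\<^sup>2 * real m powr (- c) \<le> 1 \<and> (6 * ?K * Bc * (1/4)) * ln (real m) < (ln (real m)) ^ 3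
     \<and> (ln (real m))\<^sup>2 * real m powr (- (\<alpha> / 2 + 3/4)) \<le> 1
     \<and> (2 * D * exp (l\<^sup>2 / 2)) * real m powr (- 1) \<le> \<delta> / 2) sequentially"
    using \<beta> \<delta> by (intro eventually_large_width) (auto simp: c_def)
  then obtain M where M: "\<And>m. m \<ge> M \<Longrightarrow> m > 0 \<and> ln (real m) \<ge> 1
     \<and> (3 * (?K * (1 + real CARD('d))) * Bc) * real m powr (- c) \<le> 1
     \<and> (ln (real m))\<^sup>2 * real m powr (- c) \<le> 1 \<and> (6 * ?K * Bc * (1/4)) * ln (real m) < (ln (real m)) ^ 3
     \<and> (ln (real m))\<^sup>2 * real m powr (- (\<alpha> / 2 + 3/4)) \<le> 1
     \<and> (2 * D * exp (l\<^sup>2 / 2)) * real m powr (- 1) \<le> \<delta> / 2"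
    unfolding eventually_sequentially by blast
  define C where "C = 1 + ?K + 4 * ?K * Bc / (\<alpha> - \<beta>)"
  have Cge: "1 + ?K \<le> C" "4 * ?K * Bc / (\<alpha> - \<beta>) \<le> C"
    unfolding C_def using K1 Bc0 \<beta> by auto
  show "\<exists>M::nat. \<exists>C>0. \<forall>m::nat. m \<ge> M \<and> m \<ge> 2 \<longrightarrow>
      (\<exists>E\<in>sets (init_measure m \<alpha> :: (nat \<Rightarrow> real \<times> (real^'d)) measure).
         measure (init_measure m \<alpha>) E \<ge> 1 - \<delta> \<and>
         (\<forall>\<theta>0\<in>E. \<forall>a w. grad_flow m \<sigma> f \<rho> \<theta>0 a w \<longrightarrow>
            ereal (Tp \<alpha> m) \<le> T1 \<alpha> m e1 a w \<and>
            (\<forall>k<m. \<forall>i. i \<noteq> e1 \<longrightarrow>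
               \<bar>w (Tp \<alpha> m) k $ i\<bar> \<le> C * max (ln (real m) / real m powr \<alpha>) ((ln (real m)) ^ 6 / real m ^ 3)) \<and>
            \<bar>risk m \<sigma> f \<rho> (a (Tp \<alpha> m)) (w (Tp \<alpha> m)) - risk m \<sigma> f \<rho> (a 0) (w 0)\<bar> / Tp \<alpha> m
              \<le> C / (real m powr (2 * alpha1 \<alpha> - 1) * ln (real m))))"
  proof (intro exI[of _ M] exI[of _ C] conjI allI impI)
    show "C > 0" using Cge(1) K1 by linarith
    fix m :: nat assume "m \<ge> M \<and> m \<ge> 2"
    then have "m \<ge> M" by blast
    define x where "x = real m"
    define ll where "ll = ln x"
    have m0: "m > 0" and ll1: "ll \<ge> 1"
      and M1: "(3 * (?K * (1 + real CARD('d))) * Bc) * x powr (- c) \<le> 1"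
      and M2: "ll\<^sup>2 * x powr (- c) \<le> 1"
      and M3: "(6 * ?K * Bc * (1/4)) * ll < ll ^ 3"
      and M4: "ll\<^sup>2 * x powr (- (\<alpha> / 2 + 3/4)) \<le> 1"
      and M5: "(2 * D * exp (l\<^sup>2 / 2)) * x powr (- 1) \<le> \<delta> / 2"
      using M[OF \<open>m \<ge> M\<close>] unfolding x_def ll_def by auto
    have x0: "x > 0" using m0 by (simp add: x_def)
    define s where "s = x powr (- \<alpha>)"
    have s0: "s > 0" using x0 by (simp add: s_def)
    define n where "n = ll / 4 * s"
    have n0: "n \<ge> 0" using ll1 s0 by (simp add: n_def)
    define S where "S = Bc * x * s\<^sup>2"
    define T where "T = Tp \<alpha> m"
    have Teq: "T = (\<alpha> - \<beta>) * ll" by (simp add: T_def Tp_eq \<beta>_def ll_def x_def)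
    have T0: "T > 0" using Teq \<beta> ll1 by simp
    have expT: "exp (r * T) = x powr (r * (\<alpha> - \<beta>))" for r
      using x0 by (simp add: Teq powr_def ll_def mult_ac)
    have xp: "x powr p * x powr q = x powr (p + q)" for p q by (simp add: powr_add)
    have x1: "x = x powr 1" using x0 by simp
    have s2: "s\<^sup>2 = x powr (- 2 * \<alpha>)" and s3: "s ^ 3 = x powr (- 3 * \<alpha>)"
      using x0 by (simp_all add: s_def powr_powr[symmetric] powr_realpow[symmetric] powr_powr mult_ac)
    have xs2: "x * s\<^sup>2 * exp (2 * T) = x powr (- c)"
      unfolding s2 expT by (subst x1) (simp only: xp, simp add: c_def algebra_simps)
    obtain E where E: "E \<in> sets (init_measure m \<alpha> :: (nat \<Rightarrow> real \<times> (real^'d)) measure)"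
      and pE: "measure (init_measure m \<alpha>) E \<ge> 1 - (D / Bc + 2 * m * D * exp (l\<^sup>2 / 2 - l * n / (D * real m powr - \<alpha>)))"
      and E1: "\<And>\<theta>. \<theta> \<in> E \<Longrightarrow> (\<Sum>k<m. (norm (\<theta> k))\<^sup>2) \<le> Bc * m * (real m powr - \<alpha>)\<^sup>2"
      and E2: "\<And>\<theta> k. \<theta> \<in> E \<Longrightarrow> k < m \<Longrightarrow> norm (\<theta> k) \<le> n"
      using init_measure_good_event[where 'd='d, OF m0 Bc0, of l \<alpha> n] D0 unfolding D_def l_def by auto
    have "D / Bc = \<delta> / 2" using D0 \<delta> by (simp add: Bc_def)
    moreover have "2 * m * D * exp (l\<^sup>2 / 2 - l * n / (D * real m powr - \<alpha>)) \<le> \<delta> / 2"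
    proof -
      have "l * n / (D * real m powr - \<alpha>) = 2 * ll"
        using D0 s0 unfolding x_def[symmetric] s_def[symmetric] by (simp add: l_def n_def)
      then have "exp (l\<^sup>2 / 2 - l * n / (D * real m powr - \<alpha>)) = exp (l\<^sup>2 / 2) * x powr (- 2)"
        using x0 by (simp add: powr_def ll_def exp_add[symmetric])
      then have "2 * m * D * exp (l\<^sup>2 / 2 - l * n / (D * real m powr - \<alpha>))
          = (2 * D * exp (l\<^sup>2 / 2)) * (x powr 1 * x powr (- 2))"
        using x1 by (simp add: x_def)
      also have "x powr 1 * x powr (- 2) = x powr (- 1)" by (simp only: xp) simp
      finally show ?thesis using M5 by simp
    qed
    ultimately have pE': "1 - \<delta> \<le> measure (init_measure m \<alpha>) E" using pE by linarith
    have flow: "ereal T \<le> T1 \<alpha> m e1 a w \<and>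
        (\<forall>k<m. \<forall>i. i \<noteq> e1 \<longrightarrow> \<bar>w T k $ i\<bar> \<le> C * max (ll / x powr \<alpha>) (ll ^ 6 / x ^ 3)) \<and>
        \<bar>TL.prisk m (a T) (w T) - TL.prisk m (a 0) (w 0)\<bar> / T \<le> C / (x powr (2 * \<beta> - 1) * ll)"
      if th: "\<theta> \<in> E" and gf: "grad_flow m \<sigma> f \<rho> \<theta> a w" for \<theta> a w
    proof -
      have init0: "a 0 k = fst (\<theta> k)" "w 0 k = snd (\<theta> k)" if "k < m" for k
        using gf that unfolding grad_flow_def by auto
      have nsq0: "neuron_sq (a 0) (w 0) k = (norm (\<theta> k))\<^sup>2" if "k < m" for k
        using init0[OF that] by (simp add: neuron_sq_def norm_prod_def)
      have step: "3 * (?K * (1 + real CARD('d))) * S * exp (2 * T) \<le> 1"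
        using M1 unfolding xs2[symmetric] by (simp add: S_def mult_ac)
      interpret F: two_layer_flow \<mu> f \<sigma> \<sigma>1 \<sigma>2 \<sigma>3 e1 CL L B m a w S T
      proof
        fix t k assume t: "(0::real) \<le> t" and k: "k < m"
        obtain D where D: "((\<lambda>s. TL.prisk m ((a t)(k := s)) (w t)) has_real_derivative D) (at (a t k))"
          "((\<lambda>\<tau>. a \<tau> k) has_real_derivative - D) (at t within {0..})"
          using gf t k unfolding grad_flow_def risk_eq by blast
        then show "((\<lambda>\<tau>. a \<tau> k) has_real_derivative - TL.grad_a m (a t) (w t) k) (at t within {0..})"
          using DERIV_unique[OF D(1) TL.prisk_has_derivative_a[OF k]] by simp
      next
        fix t k i assume t: "(0::real) \<le> t" and k: "k < m"
        obtain D where D: "((\<lambda>s. TL.prisk m (a t) ((w t)(k := (\<chi> j. if j = i then s else w t k $ j)))) has_real_derivative D) (at (w t k $ i))"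
          "((\<lambda>\<tau>. w \<tau> k $ i) has_real_derivative - D) (at t within {0..})"
          using gf t k unfolding grad_flow_def risk_eq by blast
        then show "((\<lambda>\<tau>. w \<tau> k $ i) has_real_derivative - TL.grad_w m (a t) (w t) k i) (at t within {0..})"
          using DERIV_unique[OF D(1) TL.prisk_has_derivative_w[OF k]] by simp
      next
        show "total_sq m (a 0) (w 0) \<le> S"
          using E1[OF th] nsq0 by (simp add: total_sq_def S_def s_def x_def)
        show "0 < S" using Bc0 x0 s0 by (simp add: S_def)
      qed (use T0 step in auto)
      have nq: "neuron_sq (a 0) (w 0) k \<le> n\<^sup>2" if "k < m" for k
        unfolding nsq0[OF that] using E2[OF th that] by (intro power_mono) auto
      note pb = F.param_bound[OF n0 nq] and rb = F.remainder_bound[OF n0 nq] and ob = F.orthogonal_bound[OF n0 nq]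
      have texp: "exp (r * t) \<le> exp (r * T)" if "t \<le> T" "0 \<le> r" for r t
        using that by (simp add: mult_left_mono)
      have "T \<le> t" if t0: "0 \<le> t" and ex: "x powr (- \<beta>) * ll \<le> qmax m a w t \<or> x powr (- gamma1 \<alpha>) * ll ^ 3 \<le> rmax m e1 a w t" for t
      proof (rule ccontr)
        assume "\<not> T \<le> t"
        then have t: "0 \<le> t" "t \<le> T" using t0 by auto
        have q: "2 * n * exp t < x powr (- \<beta>) * ll"
        proof -
          have "2 * n * exp t \<le> 2 * n * exp (1 * T)"
            using texp[OF t(2), of 1] n0 by (intro mult_left_mono) auto
          also have "\<dots> = (ll / 2) * (x powr (- \<alpha>) * x powr (1 * (\<alpha> - \<beta>)))"
            unfolding expT by (simp add: n_def s_def)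
          also have "\<dots> = (ll / 2) * x powr (- \<beta>)" by (simp only: xp) simp
          also have "\<dots> < ll * x powr (- \<beta>)" using ll1 x0 by (intro mult_strict_right_mono) auto
          finally show ?thesis by (simp add: mult.commute)
        qed
        then have "qmax m a w t < x powr (- \<beta>) * ll"
          using pb(1)[OF _ t] order_trans[OF component_le_norm_cart pb(2)[OF _ t]]
          by (subst qmax_less_iff[OF m0]) (meson le_less_trans)
        moreover have r: "6 * ?K * S * n * exp (3 * t) < x powr (- gamma1 \<alpha>) * ll ^ 3"
        proof -
          have "6 * ?K * S * n * exp (3 * t) \<le> 6 * ?K * S * n * exp (3 * T)"
            using texp[OF t(2), of 3] n0 K1 F.S0 by (intro mult_left_mono) auto
          also have "\<dots> = (6 * ?K * Bc * (1/4)) * ll * (x powr 1 * x powr (- 3 * \<alpha>) * x powr (3 * (\<alpha> - \<beta>)))"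
            unfolding expT s3[symmetric] using x1 by (simp add: S_def n_def power2_eq_square power3_eq_cube)
          also have "x powr 1 * x powr (- 3 * \<alpha>) * x powr (3 * (\<alpha> - \<beta>)) = x powr (- gamma1 \<alpha>)"
            unfolding gamma1_eq \<beta>_def[symmetric] by (simp only: xp) (simp add: algebra_simps)
          also have "(6 * ?K * Bc * (1/4)) * ll * x powr (- gamma1 \<alpha>) < ll ^ 3 * x powr (- gamma1 \<alpha>)"
            using M3 x0 by (intro mult_strict_right_mono) auto
          finally show ?thesis by (simp add: mult.commute)
        qed
        have "rmax m e1 a w t < x powr (- gamma1 \<alpha>) * ll ^ 3"
          using rb[OF _ t] r by (subst rmax_less_iff[OF m0]) (meson le_less_trans)
        ultimately show False using ex by linarith
      qed
      then have "ereal T \<le> T1 \<alpha> m e1 a w"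
        unfolding T1_def x_def[symmetric] ll_def[symmetric] \<beta>_def[symmetric] by (intro INF_greatest) auto
      moreover have "\<bar>w T k $ i\<bar> \<le> C * max (ll / x powr \<alpha>) (ll ^ 6 / x ^ 3)" if k: "k < m" and i: "i \<noteq> e1" for k i
      proof -
        let ?m = "max (ll / x powr \<alpha>) (ll ^ 6 / x ^ 3)"
        have "4 * real m * n\<^sup>2 * exp (2 * T) = 1/4 * (ll\<^sup>2 * (x * s\<^sup>2 * exp (2 * T)))"
          by (simp add: n_def x_def power_mult_distrib power2_eq_square)
        also have "\<dots> \<le> 1" unfolding xs2 using M2 by simp
        finally have ws: "\<bar>w T k $ i\<bar> \<le> 2 * n + 6 * ?K * n ^ 3 * exp (3 * T)"
          using ob[OF _ i k] by blast
        have s_eq: "s = 1 / x powr \<alpha>" by (simp add: s_def powr_minus divide_simps)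
        have 1: "2 * n \<le> ?m"
        proof -
          have "2 * n \<le> ll * s" using ll1 s0 by (simp add: n_def)
          also have "\<dots> = ll / x powr \<alpha>" by (simp add: s_eq)
          finally show ?thesis by simp
        qed
        have n3: "n ^ 3 * exp (3 * T) = 1/64 * (ll ^ 3 * x powr (- 3 * \<beta>))"
        proof -
          have "n ^ 3 * exp (3 * T) = 1/64 * (ll ^ 3 * (x powr (- 3 * \<alpha>) * x powr (3 * (\<alpha> - \<beta>))))"
            unfolding expT s3[symmetric] by (simp add: n_def power_mult_distrib power3_eq_cube)
          then show ?thesis by (simp only: xp) (simp add: algebra_simps)
        qed
        have 2: "ll ^ 3 * x powr (- 3 * \<beta>) \<le> ?m"
        proof (cases "\<alpha> \<le> 3/2")
          case True
          then have "- 3 * \<beta> = - (\<alpha> / 2 + 3/4) + - \<alpha>" by (simp add: \<beta>_def alpha1_def)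
          then have "x powr (- 3 * \<beta>) = x powr (- (\<alpha> / 2 + 3/4)) * s"
            by (simp only: s_def powr_add)
          then have "ll ^ 3 * x powr (- 3 * \<beta>) = (ll\<^sup>2 * x powr (- (\<alpha> / 2 + 3/4))) * (ll * s)"
            by (simp add: power2_eq_square power3_eq_cube)
          also have "\<dots> \<le> 1 * (ll * s)"
            using M4 ll1 s0 by (intro mult_right_mono) auto
          finally show ?thesis by (simp add: s_eq)
        next
          case False
          then have "x powr (- 3 * \<beta>) = x powr (- real 3)" by (simp add: \<beta>_def alpha1_def)
          also have "\<dots> = 1 / x ^ 3"
            using x0 powr_realpow[of x 3] by (simp add: powr_minus divide_simps)
          finally have "ll ^ 3 * x powr (- 3 * \<beta>) = ll ^ 3 / x ^ 3" by simp
          also have "\<dots> \<le> ll ^ 6 / x ^ 3"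
            using ll1 x0 by (intro divide_right_mono power_increasing) auto
          finally show ?thesis by simp
        qed
        have m0': "0 \<le> ?m" using ll1 x0 by (simp add: le_max_iff_disj)
        have "6 * ?K * n ^ 3 * exp (3 * T) = (6/64) * (?K * (ll ^ 3 * x powr (- 3 * \<beta>)))"
          using n3 by (simp add: mult.assoc)
        also have "\<dots> \<le> 1 * (?K * ?m)"
          using 2 K1 ll1 by (intro mult_mono) auto
        finally have "\<bar>w T k $ i\<bar> \<le> (1 + ?K) * ?m" using ws 1 by (simp add: algebra_simps)
        also have "\<dots> \<le> C * ?m" using Cge(1) m0' by (rule mult_right_mono)
        finally show ?thesis .
      qed
      moreover have "\<bar>TL.prisk m (a T) (w T) - TL.prisk m (a 0) (w 0)\<bar> / T \<le> C / (x powr (2 * \<beta> - 1) * ll)"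
      proof -
        have "\<bar>TL.prisk m (a T) (w T) - TL.prisk m (a 0) (w 0)\<bar> / T \<le> (4 * ?K * S * exp (2 * T)) / T"
          using T0 by (intro divide_right_mono F.prisk_change) auto
        also have "4 * ?K * S * exp (2 * T) = 4 * ?K * Bc * x powr (- c)"
          unfolding xs2[symmetric] by (simp add: S_def mult_ac)
        also have "\<dots> / T = (4 * ?K * Bc / (\<alpha> - \<beta>)) / (x powr (2 * \<beta> - 1) * ll)"
          by (simp add: Teq c_def powr_diff powr_minus divide_simps)
        also have "\<dots> \<le> C / (x powr (2 * \<beta> - 1) * ll)"
          using Cge(2) ll1 by (intro divide_right_mono) auto
        finally show ?thesis .
      qed
      ultimately show ?thesis by blast
    qed
    show "\<exists>E\<in>sets (init_measure m \<alpha> :: (nat \<Rightarrow> real \<times> (real^'d)) measure).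
         measure (init_measure m \<alpha>) E \<ge> 1 - \<delta> \<and>
         (\<forall>\<theta>0\<in>E. \<forall>a w. grad_flow m \<sigma> f \<rho> \<theta>0 a w \<longrightarrow>
            ereal (Tp \<alpha> m) \<le> T1 \<alpha> m e1 a w \<and>
            (\<forall>k<m. \<forall>i. i \<noteq> e1 \<longrightarrow>
               \<bar>w (Tp \<alpha> m) k $ i\<bar> \<le> C * max (ln (real m) / real m powr \<alpha>) ((ln (real m)) ^ 6 / real m ^ 3)) \<and>
            \<bar>risk m \<sigma> f \<rho> (a (Tp \<alpha> m)) (w (Tp \<alpha> m)) - risk m \<sigma> f \<rho> (a 0) (w 0)\<bar> / Tp \<alpha> m
              \<le> C / (real m powr (2 * alpha1 \<alpha> - 1) * ln (real m)))"
      using E pE' flow unfolding risk_eq T_def ll_def x_def \<beta>_def by blast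
  qed
qed

end
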